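(* For a quantum sequence ensemble $\mathcal{E}=\bigotimes_{l=1}^{L}\mathcal{E}^{l}$, we have \[ p_{\sf G}(\mathcal{E})=\prod_{l=1}^{L}p_{\sf G}(\mathcal{E}^{l}). \]
   Context: Let $\mathcal{E}^{l}=\{\eta_{i}^{l},\rho_{i}^{l}\}_{i\in\{1,\ldots,n_{l}\}}$, $l=1,\ldots,L$, be quantum state ensembles (density operators $\rho_i^l$ on finite-dimensional Hilbert spaces, prepared with nonzero probabilities $\eta_i^l$), and let $\mathcal{E}=\bigotimes_{l=1}^{L}\mathcal{E}^{l}=\{\eta_{\vec{c}},\rho_{\vec{c}}\}_{\vec{c}}$ with $\vec{c}=(c_1,\ldots,c_L)$, $c_l\in\{1,\ldots,n_l\}$, $\eta_{\vec{c}}=\prod_l\eta_{c_l}^l$, $\rho_{\vec{c}}=\bigotimes_l\rho_{c_l}^l$. For any ensemble $\{\eta_i,\rho_i\}_i$ with average state $\rho_0=\sum_i\eta_i\rho_i$ and a measurement (POVM) $\{M_?\}\cup\{M_i\}_i$ (outcome $M_i$ means guessing $\rho_i$, $M_?$ inconclusive), the maximum confidence to identify $\rho_x$ is $\mathcal{C}_x=\max \eta_x\mathrm{Tr}(\rho_xM_x)/\mathrm{Tr}(\rho_0M_x)$ over all measurements with $\mathrm{Tr}(\rho_0M_x)>0$; equivalently $\mathcal{C}_x=\min\{q\in\mathbb{R}\mid q\rho_0-\eta_x\rho_x\succeq0\}$. A measurement is a maximum-confidence measurement if $\mathrm{Tr}[(\mathcal{C}_i\rho_0-\eta_i\rho_i)M_i]=0$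 for every $i$. $p_{\sf G}$ of an ensemble is the maximum of the success probability $\sum_i\eta_i\mathrm{Tr}(\rho_iM_i)$ over all maximum-confidence measurements of that ensemble (for $\mathcal{E}$, indices $i$ are sequences $\vec{c}$). *)

theory Defs
  imports "Jordan_Normal_Form.Matrix"
begin

definition mtrace :: "complex mat \<Rightarrow> complex" where
  "mtrace A = (\<Sum>i<dim_row A. A $$ (i, i))"

definition psd :: "nat \<Rightarrow> complex mat \<Rightarrow> bool" where
  "psd d A \<longleftrightarrow> A \<in> carrier_mat d d \<and>
     (\<forall>v \<in> carrier_vec d. let z = (\<Sum>i<d. cnj (v $ i) * (A *\<^sub>v v) $ i) in Im z = 0 \<and> 0 \<le> Re z)"

definition density :: "nat \<Rightarrow> complex mat \<Rightarrow> bool" where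
  "density d \<rho> \<longleftrightarrow> psd d \<rho> \<and> mtrace \<rho> = 1"

definition msum :: "nat \<Rightarrow> 'i set \<Rightarrow> ('i \<Rightarrow> complex mat) \<Rightarrow> complex mat" where
  "msum d I f = mat d d (\<lambda>(j, k). \<Sum>i\<in>I. f i $$ (j, k))"

definition ensemble :: "nat \<Rightarrow> 'i set \<Rightarrow> ('i \<Rightarrow> real) \<Rightarrow> ('i \<Rightarrow> complex mat) \<Rightarrow> bool" where
  "ensemble d I \<eta> \<rho> \<longleftrightarrow> finite I \<and> I \<noteq> {} \<and> (\<forall>i\<in>I. 0 < \<eta> i \<and> density d (\<rho> i)) \<and> sum \<eta> I = 1"

definition avg_state :: "nat \<Rightarrow> 'i set \<Rightarrow> ('i \<Rightarrow> real) \<Rightarrow> ('i \<Rightarrow> complex mat) \<Rightarrow> complex mat" where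
  "avg_state d I \<eta> \<rho> = msum d I (\<lambda>i. complex_of_real (\<eta> i) \<cdot>\<^sub>m \<rho> i)"

text \<open>POVM with outcomes M_? (inconclusive) and M_i, i in I.\<close>
definition povm :: "nat \<Rightarrow> 'i set \<Rightarrow> complex mat \<Rightarrow> ('i \<Rightarrow> complex mat) \<Rightarrow> bool" where
  "povm d I Mq M \<longleftrightarrow> psd d Mq \<and> (\<forall>i\<in>I. psd d (M i)) \<and> Mq + msum d I M = 1\<^sub>m d"

definition confidence :: "nat \<Rightarrow> 'i set \<Rightarrow> ('i \<Rightarrow> real) \<Rightarrow> ('i \<Rightarrow> complex mat) \<Rightarrow> 'i \<Rightarrow> real" where
  "confidence d I \<eta> \<rho> x = Inf {q :: real.
     psd d (complex_of_real q \<cdot>\<^sub>m avg_state d I \<eta> \<rho> - complex_of_real (\<eta> x) \<cdot>\<^sub>m \<rho> x)}"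

definition maxconf_meas :: "nat \<Rightarrow> 'i set \<Rightarrow> ('i \<Rightarrow> real) \<Rightarrow> ('i \<Rightarrow> complex mat) \<Rightarrow> complex mat \<Rightarrow> ('i \<Rightarrow> complex mat) \<Rightarrow> bool" where
  "maxconf_meas d I \<eta> \<rho> Mq M \<longleftrightarrow> povm d I Mq M \<and>
     (\<forall>i\<in>I. mtrace ((complex_of_real (confidence d I \<eta> \<rho> i) \<cdot>\<^sub>m avg_state d I \<eta> \<rho>
                      - complex_of_real (\<eta> i) \<cdot>\<^sub>m \<rho> i) * M i) = 0)"

definition success_prob :: "'i set \<Rightarrow> ('i \<Rightarrow> real) \<Rightarrow> ('i \<Rightarrow> complex mat) \<Rightarrow> ('i \<Rightarrow> complex mat) \<Rightarrow> real" where
  "success_prob I \<eta> \<rho> M = (\<Sum>i\<in>I. \<eta> i * Re (mtrace (\<rho> i * M i)))"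

definition pG :: "nat \<Rightarrow> 'i set \<Rightarrow> ('i \<Rightarrow> real) \<Rightarrow> ('i \<Rightarrow> complex mat) \<Rightarrow> real" where
  "pG d I \<eta> \<rho> = Sup {success_prob I \<eta> \<rho> M | Mq M. maxconf_meas d I \<eta> \<rho> Mq M}"

definition kron :: "complex mat \<Rightarrow> complex mat \<Rightarrow> complex mat" where
  "kron A B = mat (dim_row A * dim_row B) (dim_col A * dim_col B)
     (\<lambda>(i, j). A $$ (i div dim_row B, j div dim_col B) * B $$ (i mod dim_row B, j mod dim_col B))"

text \<open>rho_c = rho^1_{c_1} (x) ... (x) rho^L_{c_L} (components indexed 0..L-1).\<close>
fun tensor_seq :: "nat \<Rightarrow> (nat \<Rightarrow> nat \<Rightarrow> complex mat) \<Rightarrow> (nat \<Rightarrow> nat) \<Rightarrow> complex mat" where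
  "tensor_seq 0 \<rho> c = 1\<^sub>m 1"
| "tensor_seq (Suc L) \<rho> c = kron (tensor_seq L \<rho> c) (\<rho> L (c L))"

end

theory Submission
  imports Defs
begin

text \<open>Write every weighted state and every measurement operator as a sum of rank-one terms, so that
  all conditions become statements about finite families of vectors. Confidences multiply: the upper
  bound follows by contracting one factor at a time, the lower bound by testing on product vectors.
  Products of maximum-confidence measurements give \<open>pG E * pG F \<le> pG (E \<otimes> F)\<close>.

  For the converse no semidefinite duality is needed. Given a maximum-confidence measurement \<open>M\<close> of
  the product, put \<open>N i = (\<Sum>j. Tr\<^sub>F ((1 \<otimes> \<mu> j \<sigma> j) M i j))\<close>, compressed to the support of the average
  state of \<open>E\<close>. Then \<open>N\<close> has the success value of \<open>M\<close> and satisfies the maximum-confidence condition for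
  \<open>E\<close>. For a vector \<open>u\<close> in that support, contracting \<open>M\<close> with \<open>u\<close> on the first factor yields
  \<open>\<parallel>u\<parallel>\<^sup>2\<close> times a maximum-confidence measurement of \<open>F\<close>, whence \<open>(\<Sum>i. N i) \<le> pG F\<close> and the
  value of \<open>N\<close> is at most \<open>pG F * pG E\<close>.\<close>

section \<open>Inner products and quadratic forms of finite families of vectors\<close>

definition ip :: "nat \<Rightarrow> (nat \<Rightarrow> complex) \<Rightarrow> (nat \<Rightarrow> complex) \<Rightarrow> complex" where
  "ip d u v = (\<Sum>i<d. cnj (u i) * v i)"

definition nsq :: "nat \<Rightarrow> (nat \<Rightarrow> complex) \<Rightarrow> real" where
  "nsq d u = (\<Sum>i<d. (cmod (u i))\<^sup>2)"

text \<open>The expectation \<open>\<langle>x|A|x\<rangle>\<close> of the operator \<open>A\<close>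
  that sums the rank-one terms of the vectors \<open>a k\<close>. In this form positive semidefinite
  operators are handled without matrices.\<close>

definition qsum :: "nat \<Rightarrow> 'k set \<Rightarrow> ('k \<Rightarrow> nat \<Rightarrow> complex) \<Rightarrow> (nat \<Rightarrow> complex) \<Rightarrow> real" where
  "qsum d K a x = (\<Sum>k\<in>K. (cmod (ip d (a k) x))\<^sup>2)"

lemma ip_self: "ip d u u = complex_of_real (nsq d u)"
  unfolding ip_def nsq_def of_real_sum
  by (rule sum.cong) (simp_all only: complex_norm_square mult.commute)

lemma cnj_ip: "cnj (ip d u v) = ip d v u"
  by (simp add: ip_def mult.commute)

lemma cmod_ip_commute: "cmod (ip d u v) = cmod (ip d v u)"
  by (metis cnj_ip complex_mod_cnj)

lemma ip_add_right: "ip d u (\<lambda>i. v i + w i) = ip d u v + ip d u w"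
  by (simp add: ip_def algebra_simps sum.distrib)

lemma ip_diff_right: "ip d u (\<lambda>i. v i - w i) = ip d u v - ip d u w"
  by (simp add: ip_def algebra_simps sum_subtractf)

lemma ip_scale_right: "ip d u (\<lambda>i. c * v i) = c * ip d u v"
  by (simp add: ip_def sum_distrib_left algebra_simps)

lemma ip_add_left: "ip d (\<lambda>i. v i + w i) u = ip d v u + ip d w u"
  by (simp add: ip_def algebra_simps sum.distrib)

lemma ip_scale_left: "ip d (\<lambda>i. c * v i) u = cnj c * ip d v u"
  by (simp add: ip_def sum_distrib_left algebra_simps)

lemma ip_zero_left: "ip d (\<lambda>i. 0) u = 0"
  by (simp add: ip_def)

lemmas ip_linear = ip_add_right ip_diff_right ip_scale_right ip_add_left ip_scale_left ip_zero_left

lemma nsq_nonneg: "0 \<le> nsq d u"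
  by (simp add: nsq_def sum_nonneg)

lemma qsum_nonneg: "0 \<le> qsum d K a x"
  by (simp add: qsum_def sum_nonneg)

text \<open>Holds square by square. Being an identity, it passes to differences of such forms, where
  it shows that the zeros of a nonnegative difference are closed under addition.\<close>

lemma qsum_parallelogram:
  "qsum d K a (\<lambda>i. x i + y i) + qsum d K a (\<lambda>i. x i - y i) = 2 * qsum d K a x + 2 * qsum d K a y"
proof -
  have "(cmod (z + w))\<^sup>2 + (cmod (z - w))\<^sup>2 = 2 * (cmod z)\<^sup>2 + 2 * (cmod w)\<^sup>2" for z w
    unfolding cmod_power2 by (simp add: power2_eq_square algebra_simps)
  then show ?thesis
    unfolding qsum_def ip_linear sum_distrib_left sum.distrib[symmetric] by simp
qed

lemma qsum_scale: "qsum d K a (\<lambda>i. c * x i) = (cmod c)\<^sup>2 * qsum d K a x"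
  by (simp add: qsum_def ip_linear norm_mult power_mult_distrib sum_distrib_left)

subsection \<open>Orthogonal projection onto the span of a finite family\<close>

inductive_set cspan :: "(nat \<Rightarrow> complex) set \<Rightarrow> (nat \<Rightarrow> complex) set" for B where
  zero: "(\<lambda>i. 0) \<in> cspan B"
| step: "x \<in> cspan B \<Longrightarrow> b \<in> B \<Longrightarrow> (\<lambda>i. x i + c * b i) \<in> cspan B"

lemma cspan_add: "x \<in> cspan B \<Longrightarrow> y \<in> cspan B \<Longrightarrow> (\<lambda>i. x i + y i) \<in> cspan B"
proof (induction rule: cspan.induct)
  case (step x b c)
  then have "(\<lambda>i. (x i + y i) + c * b i) \<in> cspan B" by (intro cspan.step)
  then show ?case by (simp add: algebra_simps)
qed simp

lemma cspan_scale: "x \<in> cspan B \<Longrightarrow> (\<lambda>i. e * x i) \<in> cspan B"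
proof (induction rule: cspan.induct)
  case zero
  then show ?case by (simp add: cspan.zero)
next
  case (step x b c)
  then have "(\<lambda>i. e * x i + (e * c) * b i) \<in> cspan B" by (intro cspan.step)
  then show ?case by (simp add: algebra_simps)
qed

lemma cspan_base: "b \<in> B \<Longrightarrow> b \<in> cspan B"
  using cspan.step[OF cspan.zero, of b B 1] by simp

lemma cspan_mono: "x \<in> cspan B \<Longrightarrow> B \<subseteq> C \<Longrightarrow> x \<in> cspan C"
  by (induction rule: cspan.induct) (auto intro: cspan.intros)

lemma cspan_orth: "x \<in> cspan B \<Longrightarrow> (\<And>b. b \<in> B \<Longrightarrow> ip d b u = 0) \<Longrightarrow> ip d x u = 0"
  by (induction rule: cspan.induct) (auto simp: ip_linear)

text \<open>Gram-Schmidt: split off the part \<open>q\<close> of the new vector that is orthogonal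
  to the earlier ones, and add to the earlier projection the component of \<open>u\<close> along
  \<open>q\<close>.\<close>

lemma projection_exists:
  assumes "finite B"
  shows "\<exists>y \<in> cspan B. \<forall>b\<in>B. ip d b (\<lambda>i. u i - y i) = 0"
  using assms
proof (induction arbitrary: u rule: finite_induct)
  case empty
  then show ?case using cspan.zero by auto
next
  case (insert r B)
  obtain y where y: "y \<in> cspan B" "\<And>b. b \<in> B \<Longrightarrow> ip d b (\<lambda>i. u i - y i) = 0"
    using insert.IH[of u] by blast
  obtain p where p: "p \<in> cspan B" "\<And>b. b \<in> B \<Longrightarrow> ip d b (\<lambda>i. r i - p i) = 0"
    using insert.IH[of r] by blast
  define q where "q = (\<lambda>i. r i - p i)"
  define c where "c = ip d q (\<lambda>i. u i - y i) / ip d q q"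
  define z where "z = (\<lambda>i. y i + c * q i)"
  have sp: "x \<in> cspan (insert r B)" if "x \<in> cspan B" for x
    using cspan_mono[OF that] by blast
  have "q = (\<lambda>i. r i + (-1) * p i)" by (simp add: q_def)
  then have "q \<in> cspan (insert r B)"
    using cspan_add[OF cspan_base[of r "insert r B"] cspan_scale[OF sp[OF p(1)], of "-1"]] by simp
  then have zs: "z \<in> cspan (insert r B)"
    unfolding z_def using y(1) by (intro cspan_add cspan_scale) (auto intro: sp)
  have uz: "(\<lambda>i. u i - z i) = (\<lambda>i. (u i - y i) - c * q i)" by (simp add: z_def algebra_simps)
  have zB: "ip d b (\<lambda>i. u i - z i) = 0" if "b \<in> B" for b
    using y(2)[OF that] p(2)[OF that] unfolding uz ip_linear by (simp add: q_def ip_linear)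
  \<comment> \<open>If \<open>q\<close> has norm zero, its entries below \<open>d\<close> vanish and
    orthogonality to it is automatic; otherwise \<open>c\<close> is the coefficient along
    \<open>q\<close>.\<close>
  have zq: "ip d q (\<lambda>i. u i - z i) = 0"
  proof (cases "ip d q q = 0")
    case True
    then have "nsq d q = 0" by (simp add: ip_self)
    then have "\<And>i. i < d \<Longrightarrow> q i = 0" by (simp add: nsq_def sum_nonneg_eq_0_iff)
    then show ?thesis by (simp add: ip_def)
  next
    case False
    have "ip d q (\<lambda>i. u i - z i) = ip d q (\<lambda>i. u i - y i) - c * ip d q q"
      unfolding uz using ip_diff_right[of d q "\<lambda>i. u i - y i" "\<lambda>i. c * q i"]
      by (simp add: ip_scale_right)
    with False show ?thesis by (simp add: c_def)
  qed
  have "r = (\<lambda>i. p i + q i)" by (simp add: q_def)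
  then have "ip d r (\<lambda>i. u i - z i) = ip d p (\<lambda>i. u i - z i) + ip d q (\<lambda>i. u i - z i)"
    by (metis ip_add_left)
  also have "ip d p (\<lambda>i. u i - z i) = 0"
    using p(1) zB by (rule cspan_orth)
  finally have "ip d r (\<lambda>i. u i - z i) = 0" using zq by simp
  with zs zB show ?case by blast
qed

text \<open>Pythagoras: the residual is orthogonal to the whole span, hence to
  \<open>y\<close>.\<close>

lemma nsq_projection_le:
  assumes "y \<in> cspan B" "\<And>b. b \<in> B \<Longrightarrow> ip d b (\<lambda>i. u i - y i) = 0"
  shows "nsq d y \<le> nsq d u"
proof -
  let ?e = "\<lambda>i. u i - y i"
  have o: "ip d y ?e = 0" using assms by (rule cspan_orth)
  then have o': "ip d ?e y = 0" by (metis cnj_ip complex_cnj_zero)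
  have "ip d u u = ip d (\<lambda>i. y i + ?e i) (\<lambda>i. y i + ?e i)" by simp
  also have "\<dots> = ip d y y + ip d ?e ?e"
    by (subst ip_add_right, subst ip_add_left, subst ip_add_left) (simp add: o o')
  finally have "nsq d u = nsq d y + nsq d ?e"
    unfolding ip_self by (metis of_real_add of_real_eq_iff)
  then show ?thesis using nsq_nonneg[of d ?e] by simp
qed

subsection \<open>Positive semidefinite matrices as Gram matrices\<close>

definition sform :: "nat \<Rightarrow> (nat \<Rightarrow> nat \<Rightarrow> complex) \<Rightarrow> (nat \<Rightarrow> complex) \<Rightarrow> (nat \<Rightarrow> complex) \<Rightarrow> complex" where
  "sform d B x y = (\<Sum>i<d. \<Sum>j<d. cnj (x i) * B i j * y j)"

definition posf :: "nat \<Rightarrow> (nat \<Rightarrow> nat \<Rightarrow> complex) \<Rightarrow> bool" where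
  "posf d B \<longleftrightarrow> (\<forall>x. Im (sform d B x x) = 0 \<and> 0 \<le> Re (sform d B x x))"

definition gram :: "nat \<Rightarrow> 'k set \<Rightarrow> ('k \<Rightarrow> nat \<Rightarrow> complex) \<Rightarrow> complex mat" where
  "gram d K a = mat d d (\<lambda>(i, j). \<Sum>k\<in>K. a k i * cnj (a k j))"

lemma sform_cong: "(\<And>i j. i < d \<Longrightarrow> j < d \<Longrightarrow> A i j = B i j) \<Longrightarrow> sform d A x y = sform d B x y"
  by (simp add: sform_def)

lemma sform_diff: "sform d (\<lambda>i j. A i j - B i j) x y = sform d A x y - sform d B x y"
  by (simp add: sform_def algebra_simps sum_subtractf)

lemma sform_add: "sform d (\<lambda>i j. A i j + B i j) x y = sform d A x y + sform d B x y"
  by (simp add: sform_def algebra_simps sum.distrib)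

lemma sform_scale: "sform d (\<lambda>i j. c * A i j) x y = c * sform d A x y"
  by (simp add: sform_def algebra_simps sum_distrib_left)

lemma sform_sum: "sform d (\<lambda>i j. \<Sum>k\<in>K. A k i j) x y = (\<Sum>k\<in>K. sform d (A k) x y)"
proof -
  have "(\<Sum>i<d. \<Sum>j<d. \<Sum>k\<in>K. cnj (x i) * A k i j * y j)
      = (\<Sum>k\<in>K. \<Sum>i<d. \<Sum>j<d. cnj (x i) * A k i j * y j)"
    by (subst (2) sum.swap, subst (1) sum.swap) simp
  then show ?thesis by (simp add: sform_def sum_distrib_left sum_distrib_right)
qed

lemma sform_rank_one: "sform d (\<lambda>i j. a i * cnj (a j)) x x = complex_of_real ((cmod (ip d a x))\<^sup>2)"
proof -
  have "sform d (\<lambda>i j. a i * cnj (a j)) x x = ip d x a * ip d a x"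
    unfolding sform_def ip_def sum_product by (simp add: algebra_simps)
  also have "\<dots> = complex_of_real ((cmod (ip d a x))\<^sup>2)"
    unfolding complex_norm_square cnj_ip by (simp add: mult.commute)
  finally show ?thesis .
qed

lemma sform_gram: "sform d (\<lambda>i j. gram d K a $$ (i, j)) x x = complex_of_real (qsum d K a x)"
proof -
  have "sform d (\<lambda>i j. gram d K a $$ (i, j)) x x = sform d (\<lambda>i j. \<Sum>k\<in>K. a k i * cnj (a k j)) x x"
    by (rule sform_cong) (simp add: gram_def)
  also have "\<dots> = complex_of_real (qsum d K a x)"
    unfolding sform_sum sform_rank_one qsum_def by simp
  finally show ?thesis .
qed

text \<open>Vectors become functions on the naturals whose entries from \<open>d\<close> on are
  ignored, which frees later arguments from carrier conditions on vectors.\<close>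

lemma psd_iff_posf: "psd d A \<longleftrightarrow> A \<in> carrier_mat d d \<and> posf d (\<lambda>i j. A $$ (i, j))"
proof -
  have eq: "(\<Sum>i<d. cnj (v $ i) * (A *\<^sub>v v) $ i) = sform d (\<lambda>i j. A $$ (i, j)) (($) v) (($) v)"
    if "A \<in> carrier_mat d d" "v \<in> carrier_vec d" for v
    unfolding sform_def using that
    by (intro sum.cong refl) (auto simp: scalar_prod_def sum_distrib_left mult.assoc atLeast0LessThan)
  show ?thesis
  proof
    assume A: "psd d A"
    then have c: "A \<in> carrier_mat d d" by (simp add: psd_def)
    have "Im (sform d (\<lambda>i j. A $$ (i, j)) x x) = 0 \<and> 0 \<le> Re (sform d (\<lambda>i j. A $$ (i, j)) x x)" for x
    proof -
      have "sform d (\<lambda>i j. A $$ (i, j)) x x = sform d (\<lambda>i j. A $$ (i, j)) (($) (vec d x)) (($) (vec d x))"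
        by (simp add: sform_def)
      also have "\<dots> = (\<Sum>i<d. cnj (vec d x $ i) * (A *\<^sub>v vec d x) $ i)"
        using eq[OF c, of "vec d x"] by simp
      finally show ?thesis using A unfolding psd_def Let_def by (metis vec_carrier)
    qed
    with c show "A \<in> carrier_mat d d \<and> posf d (\<lambda>i j. A $$ (i, j))" by (simp add: posf_def)
  next
    assume "A \<in> carrier_mat d d \<and> posf d (\<lambda>i j. A $$ (i, j))"
    then show "psd d A" by (auto simp: psd_def Let_def posf_def eq)
  qed
qed

lemma psd_gram: "psd d (gram d K a)"
  unfolding psd_iff_posf posf_def sform_gram by (simp add: gram_def qsum_nonneg)

definition uvec :: "nat \<Rightarrow> nat \<Rightarrow> complex" where
  "uvec m i = (if i = m then 1 else 0)"

lemma sform_expand: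
  "sform d B (\<lambda>i. x i + t * y i) (\<lambda>i. x i + t * y i)
   = sform d B x x + t * sform d B x y + cnj t * sform d B y x + cnj t * t * sform d B y y"
  by (simp add: sform_def algebra_simps sum.distrib sum_distrib_left)

lemma sform_uvec_left: "m < d \<Longrightarrow> sform d B (uvec m) x = (\<Sum>j<d. B m j * x j)"
  by (simp add: sform_def uvec_def if_distrib if_distribR sum.delta cong: if_cong)
     (subst sum.swap, simp add: sum.delta)

lemma sform_uvec: "m < d \<Longrightarrow> k < d \<Longrightarrow> sform d B (uvec m) (uvec k) = B m k"
  by (simp add: sform_uvec_left) (simp add: uvec_def if_distrib cong: if_cong)

text \<open>Polarisation: the form is real on \<open>uvec i + t * uvec j\<close>;
  \<open>t = 1\<close> compares the imaginary parts of the two entries and \<open>t = \<i>\<close>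
  the real parts.\<close>

lemma posf_hermitian:
  assumes "posf d B" "i < d" "j < d"
  shows "B j i = cnj (B i j)"
proof -
  have "Im (sform d B (\<lambda>k. uvec i k + t * uvec j k) (\<lambda>k. uvec i k + t * uvec j k)) = 0" for t
    using assms by (simp add: posf_def)
  moreover have "Im (B i i) = 0" "Im (B j j) = 0"
    using assms sform_uvec[of i d i B] sform_uvec[of j d j B] unfolding posf_def by metis+
  ultimately have *: "Im (t * B i j + cnj t * B j i + cnj t * t * B j j) = 0" for t
    unfolding sform_expand using assms by (simp add: sform_uvec)
  have "Im (B i j) + Im (B j i) = 0" using *[of 1] \<open>Im (B j j) = 0\<close> by simp
  moreover have "Re (B i j) = Re (B j i)" using *[of \<i>] \<open>Im (B j j) = 0\<close> by simp
  ultimately show ?thesis by (simp add: complex_eq_iff)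
qed

lemma sform_uvec_right:
  assumes "posf d B" "m < d"
  shows "sform d B x (uvec m) = cnj (\<Sum>j<d. B m j * x j)"
proof -
  have "sform d B x (uvec m) = (\<Sum>i<d. cnj (x i) * B i m)"
    using assms(2) by (simp add: sform_def uvec_def if_distrib sum.delta cong: if_cong)
  also have "\<dots> = cnj (\<Sum>j<d. B m j * x j)"
    using posf_hermitian[OF assms(1) assms(2)] by (simp add: mult.commute)
  finally show ?thesis .
qed

text \<open>One step of the Cholesky decomposition: a rank-one term is split off which clears row m.\<close>

lemma cholesky_step:
  assumes B: "posf d B" and m: "m < d"
  shows "\<exists>a. posf d (\<lambda>i j. B i j - a i * cnj (a j)) \<and> (\<forall>j<d. B m j = a m * cnj (a j)) \<and>
             (\<forall>i<d. B i m = 0 \<longrightarrow> a i = 0)"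
proof -
  define b where "b = Re (B m m)"
  define r where "r x = (\<Sum>j<d. B m j * x j)" for x
  have "Im (B m m) = 0" "b \<ge> 0"
    using B m sform_uvec[of m d m B] unfolding posf_def b_def by metis+
  then have bm: "B m m = complex_of_real b" by (simp add: b_def complex_eq_iff)
  \<comment> \<open>Positivity along the direction \<open>uvec m\<close>, a quadratic inequality in
    the complex number \<open>t\<close>.\<close>
  have ge: "0 \<le> Re (sform d B x x) + 2 * Re (t * cnj (r x)) + (cmod t)\<^sup>2 * b" for x t
  proof -
    have "0 \<le> Re (sform d B (\<lambda>i. x i + t * uvec m i) (\<lambda>i. x i + t * uvec m i))"
      using B by (simp add: posf_def)
    also have "sform d B (\<lambda>i. x i + t * uvec m i) (\<lambda>i. x i + t * uvec m i) =
      sform d B x x + (t * cnj (r x) + cnj (t * cnj (r x))) + cnj t * t * complex_of_real b"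
      unfolding sform_expand sform_uvec_left[OF m] sform_uvec_right[OF B m]
        using sform_uvec[OF m m, of B, unfolded sform_uvec_left[OF m]] by (simp add: bm r_def)
    also have "t * cnj (r x) + cnj (t * cnj (r x)) = complex_of_real (2 * Re (t * cnj (r x)))"
      by (rule complex_add_cnj)
    also have "cnj t * t = complex_of_real ((cmod t)\<^sup>2)"
      by (simp only: complex_norm_square mult.commute)
    finally show ?thesis by simp
  qed
  show ?thesis
  proof (cases "b = 0")
    case True
    have "r x = 0" for x
    proof (rule ccontr)
      assume "r x \<noteq> 0"
      \<comment> \<open>With \<open>b = 0\<close> the inequality \<open>ge\<close> is affine in
        \<open>t\<close>; this \<open>s\<close> makes \<open>t = - s * r x\<close> push it below
        zero.\<close>
      define s where "s = (Re (sform d B x x) + 1) / (cmod (r x))\<^sup>2"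
      have "Re (- complex_of_real s * r x * cnj (r x)) = - (s * Re (r x * cnj (r x)))"
        by (simp add: algebra_simps)
      also have "r x * cnj (r x) = complex_of_real ((cmod (r x))\<^sup>2)"
        by (simp only: complex_norm_square)
      also have "- (s * Re (complex_of_real ((cmod (r x))\<^sup>2))) = - (s * (cmod (r x))\<^sup>2)"
        by (simp del: of_real_power)
      also have "\<dots> = - (Re (sform d B x x) + 1)"
        using \<open>r x \<noteq> 0\<close> by (simp add: s_def)
      finally have "0 \<le> Re (sform d B x x) - 2 * (Re (sform d B x x) + 1)"
        using ge[of x "- complex_of_real s * r x"] True by simp
      moreover have "0 \<le> Re (sform d B x x)" using B by (simp add: posf_def)
      ultimately show False by simp
    qed
    then have "B m j = 0" if "j < d" for j
      using that by (metis r_def sform_uvec sform_uvec_left m)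
    then show ?thesis using B by (intro exI[of _ "\<lambda>_. 0"]) simp
  next
    case False
    with \<open>b \<ge> 0\<close> have "b > 0" by simp
    \<comment> \<open>Column \<open>m\<close> divided by the square root of the diagonal entry, so
      that \<open>a m * cnj (a j)\<close> gives back row \<open>m\<close>.\<close>
    define a where "a i = B i m / complex_of_real (sqrt b)" for i
    have sq: "complex_of_real (sqrt b) * complex_of_real (sqrt b) = complex_of_real b"
      using \<open>b > 0\<close> by (simp flip: of_real_mult)
    have "B m j = a m * cnj (a j)" if "j < d" for j
      using posf_hermitian[OF B m that] sq \<open>b > 0\<close> by (simp add: a_def bm)
    moreover have "posf d (\<lambda>i j. B i j - a i * cnj (a j))"
      unfolding posf_def
    proof (intro allI)
      fix x
      have "ip d a x = r x / complex_of_real (sqrt b)"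
        using posf_hermitian[OF B m] by (simp add: ip_def r_def a_def sum_divide_distrib)
      then have "(cmod (ip d a x))\<^sup>2 = (cmod (r x))\<^sup>2 / b"
        using \<open>b > 0\<close> by (simp add: norm_divide power_divide)
      then have eq: "sform d (\<lambda>i j. B i j - a i * cnj (a j)) x x
          = sform d B x x - complex_of_real ((cmod (r x))\<^sup>2 / b)"
        by (simp add: sform_diff sform_rank_one del: of_real_power of_real_divide)
      have c: "cmod (r x / complex_of_real b) ^ 2 * b = (cmod (r x))\<^sup>2 / b"
        using \<open>b > 0\<close> by (simp add: norm_divide power_divide power2_eq_square)
      have "r x * cnj (r x) = complex_of_real ((cmod (r x))\<^sup>2)" by (simp only: complex_norm_square)
      then have e: "Re (- (r x / complex_of_real b) * cnj (r x)) = - ((cmod (r x))\<^sup>2 / b)"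
        by (simp add: Re_divide_of_real del: of_real_power)
      \<comment> \<open>The choice \<open>t = - r x / b\<close> minimises the quadratic in
        \<open>ge\<close>; the minimum is the value of the form after the rank-one term is
        removed.\<close>
      have "(cmod (r x))\<^sup>2 / b \<le> Re (sform d B x x)"
        using ge[of x "- (r x / complex_of_real b)"] unfolding norm_minus_cancel c e by simp
      moreover have "Im (sform d B x x) = 0" using B by (simp add: posf_def)
      ultimately show "Im (sform d (\<lambda>i j. B i j - a i * cnj (a j)) x x) = 0 \<and>
          0 \<le> Re (sform d (\<lambda>i j. B i j - a i * cnj (a j)) x x)"
        unfolding eq by (simp del: of_real_power of_real_divide)
    qed
    moreover have "\<forall>i<d. B i m = 0 \<longrightarrow> a i = 0" by (simp add: a_def)
    ultimately show ?thesis by blast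
  qed
qed

text \<open>Cholesky: after \<open>m\<close> steps the remainder is positive semidefinite and its
  first \<open>m\<close> rows are zero, so after \<open>d\<close> steps nothing is left.\<close>

lemma psd_imp_gram:
  assumes "psd d A"
  shows "\<exists>a :: nat \<Rightarrow> nat \<Rightarrow> complex. A = gram d {..<d} a"
proof -
  from assms have c: "A \<in> carrier_mat d d" and p: "posf d (\<lambda>i j. A $$ (i, j))"
    by (simp_all add: psd_iff_posf)
  have "m \<le> d \<Longrightarrow> \<exists>a :: nat \<Rightarrow> nat \<Rightarrow> complex.
      posf d (\<lambda>i j. A $$ (i, j) - (\<Sum>k<m. a k i * cnj (a k j))) \<and>
      (\<forall>i<m. \<forall>j<d. A $$ (i, j) - (\<Sum>k<m. a k i * cnj (a k j)) = 0)" for m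
  proof (induction m)
    case 0
    with p show ?case by simp
  next
    case (Suc m)
    then have m: "m < d" by simp
    from Suc obtain a :: "nat \<Rightarrow> nat \<Rightarrow> complex" where
      a: "posf d (\<lambda>i j. A $$ (i, j) - (\<Sum>k<m. a k i * cnj (a k j)))"
         "\<And>i j. i < m \<Longrightarrow> j < d \<Longrightarrow> A $$ (i, j) - (\<Sum>k<m. a k i * cnj (a k j)) = 0"
      using Suc_leD by blast
    define B where "B = (\<lambda>i j. A $$ (i, j) - (\<Sum>k<m. a k i * cnj (a k j)))"
    have B: "posf d B" using a(1) by (simp add: B_def)
    have B0: "B i j = 0" if "i < m" "j < d" for i j using a(2) that by (simp add: B_def)
    obtain b where b: "posf d (\<lambda>i j. B i j - b i * cnj (b j))"
      "\<And>j. j < d \<Longrightarrow> B m j = b m * cnj (b j)" "\<And>i. i < d \<Longrightarrow> B i m = 0 \<Longrightarrow> b i = 0"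
      using cholesky_step[OF B m] by blast
    define a' where "a' = a(m := b)"
    have s: "(\<Sum>k<Suc m. a' k i * cnj (a' k j)) = (\<Sum>k<m. a k i * cnj (a k j)) + b i * cnj (b j)" for i j
      by (simp add: a'_def)
    have eq: "A $$ (i, j) - (\<Sum>k<Suc m. a' k i * cnj (a' k j)) = B i j - b i * cnj (b j)" for i j
      unfolding s B_def by simp
    have "B i j - b i * cnj (b j) = 0" if "i < Suc m" "j < d" for i j
    proof (cases "i = m")
      case True
      with b(2) that show ?thesis by simp
    next
      case False
      \<comment> \<open>Row \<open>i\<close> was cleared earlier, so \<open>B i m\<close> is zero
        and forces \<open>b i = 0\<close>: cleared rows stay cleared.\<close>
      with that have "i < m" by simp
      with B0 m that b(3) show ?thesis by simp
    qed
    then show ?case using b(1) unfolding eq[symmetric] by blast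
  qed
  from this[of d] obtain a :: "nat \<Rightarrow> nat \<Rightarrow> complex" where
    a: "\<And>i j. i < d \<Longrightarrow> j < d \<Longrightarrow> A $$ (i, j) - (\<Sum>k<d. a k i * cnj (a k j)) = 0" by blast
  have "A = gram d {..<d} a"
    using c a by (intro eq_matI) (auto simp: gram_def)
  then show ?thesis by blast
qed

subsection \<open>Maximum-confidence measurements as families of vectors\<close>

text \<open>The operator \<open>M i\<close> of a measurement is encoded by vectors \<open>m i l\<close>, \<open>l \<in> L\<close>, with
  \<open>M i = (\<Sum>l\<in>L. |m i l\<rangle>\<langle>m i l| )\<close>. Then \<open>tight\<close> is the maximum-confidence condition, \<open>frame_le\<close> with
  \<open>c = 1\<close> is the existence of the inconclusive outcome, and \<open>gain\<close> is the success probability.\<close>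

definition represents :: "nat \<Rightarrow> 'i set \<Rightarrow> ('i \<Rightarrow> real) \<Rightarrow> ('i \<Rightarrow> complex mat) \<Rightarrow>
    'k set \<Rightarrow> ('i \<Rightarrow> 'k \<Rightarrow> nat \<Rightarrow> complex) \<Rightarrow> bool" where
  "represents d I \<eta> \<rho> K w \<longleftrightarrow> finite I \<and> finite K \<and>
     (\<forall>i\<in>I. complex_of_real (\<eta> i) \<cdot>\<^sub>m \<rho> i = gram d K (w i)) \<and>
     (\<forall>i\<in>I. \<exists>x. 0 < qsum d K (w i) x)"

text \<open>The expectation of the average state, the weights being absorbed into the vectors
  \<open>w i\<close>.\<close>

definition tot :: "nat \<Rightarrow> 'i set \<Rightarrow> 'k set \<Rightarrow> ('i \<Rightarrow> 'k \<Rightarrow> nat \<Rightarrow> complex) \<Rightarrow> (nat \<Rightarrow> complex) \<Rightarrow> real" where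
  "tot d I K w x = (\<Sum>i\<in>I. qsum d K (w i) x)"

definition conf :: "nat \<Rightarrow> 'i set \<Rightarrow> 'k set \<Rightarrow> ('i \<Rightarrow> 'k \<Rightarrow> nat \<Rightarrow> complex) \<Rightarrow> 'i \<Rightarrow> real" where
  "conf d I K w i = Inf {q. \<forall>x. qsum d K (w i) x \<le> q * tot d I K w x}"

definition tight :: "nat \<Rightarrow> 'i set \<Rightarrow> 'k set \<Rightarrow> ('i \<Rightarrow> 'k \<Rightarrow> nat \<Rightarrow> complex) \<Rightarrow>
    'l set \<Rightarrow> ('i \<Rightarrow> 'l \<Rightarrow> nat \<Rightarrow> complex) \<Rightarrow> bool" where
  "tight d I K w L m \<longleftrightarrow>
     (\<forall>i\<in>I. \<forall>l\<in>L. qsum d K (w i) (m i l) = conf d I K w i * tot d I K w (m i l))"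

definition frame_le :: "nat \<Rightarrow> 'i set \<Rightarrow> 'l set \<Rightarrow> ('i \<Rightarrow> 'l \<Rightarrow> nat \<Rightarrow> complex) \<Rightarrow> real \<Rightarrow> bool" where
  "frame_le d I L m c \<longleftrightarrow> (\<forall>u. (\<Sum>i\<in>I. qsum d L (m i) u) \<le> c * nsq d u)"

definition gain :: "nat \<Rightarrow> 'i set \<Rightarrow> 'k set \<Rightarrow> ('i \<Rightarrow> 'k \<Rightarrow> nat \<Rightarrow> complex) \<Rightarrow>
    'l set \<Rightarrow> ('i \<Rightarrow> 'l \<Rightarrow> nat \<Rightarrow> complex) \<Rightarrow> real" where
  "gain d I K w L m = (\<Sum>i\<in>I. \<Sum>l\<in>L. qsum d K (w i) (m i l))"

section \<open>Translation between measurement operators and vector families\<close>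

lemma gram_carrier: "gram d K a \<in> carrier_mat d d"
  by (simp add: gram_def)

text \<open>Turns the trace conditions on a measurement into sums of form values at its
  vectors.\<close>

lemma mtrace_mult_gram:
  assumes "A \<in> carrier_mat d d"
  shows "mtrace (A * gram d K a) = (\<Sum>k\<in>K. sform d (\<lambda>i j. A $$ (i, j)) (a k) (a k))"
proof -
  have "mtrace (A * gram d K a) = (\<Sum>i<d. \<Sum>j<d. A $$ (i, j) * (\<Sum>k\<in>K. a k j * cnj (a k i)))"
    unfolding mtrace_def using assms
    by (intro sum.cong) (auto simp: gram_def scalar_prod_def atLeast0LessThan)
  also have "\<dots> = (\<Sum>i<d. \<Sum>j<d. \<Sum>k\<in>K. cnj (a k i) * A $$ (i, j) * a k j)"
    by (simp add: sum_distrib_left algebra_simps)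
  also have "\<dots> = (\<Sum>k\<in>K. \<Sum>i<d. \<Sum>j<d. cnj (a k i) * A $$ (i, j) * a k j)"
    by (subst (2) sum.swap, subst (1) sum.swap) simp
  finally show ?thesis by (simp add: sform_def)
qed

lemma tot_nonneg: "0 \<le> tot d I K w x"
  by (simp add: tot_def sum_nonneg qsum_nonneg)

lemma qsum_le_tot: "finite I \<Longrightarrow> i \<in> I \<Longrightarrow> qsum d K (w i) x \<le> tot d I K w x"
  unfolding tot_def by (rule member_le_sum) (simp_all add: qsum_nonneg)

lemma tot_parallelogram:
  "tot d I K w (\<lambda>i. x i + y i) + tot d I K w (\<lambda>i. x i - y i) = 2 * tot d I K w x + 2 * tot d I K w y"
  unfolding tot_def sum_distrib_left sum.distrib[symmetric] qsum_parallelogram ..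

lemma tot_scale: "tot d I K w (\<lambda>i. c * x i) = (cmod c)\<^sup>2 * tot d I K w x"
  by (simp add: tot_def qsum_scale sum_distrib_left)

lemma gain_nonneg: "0 \<le> gain d I K w L m"
  by (simp add: gain_def sum_nonneg qsum_nonneg)

text \<open>Every admissible \<open>q\<close> dominates all quotients of \<open>qsum\<close> by
  \<open>tot\<close>, hence so does the infimum, which is therefore admissible itself. The value 1
  is always admissible, and a vector on which the weighted state is positive bounds the set from
  below and makes the infimum positive.\<close>

lemma
  assumes "represents d I \<eta> \<rho> K w" "i \<in> I"
  shows qsum_le_conf: "qsum d K (w i) x \<le> conf d I K w i * tot d I K w x"
    and conf_le: "(\<And>x. qsum d K (w i) x \<le> q * tot d I K w x) \<Longrightarrow> conf d I K w i \<le> q"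
    and conf_pos: "0 < conf d I K w i"
proof -
  let ?S = "{q. \<forall>x. qsum d K (w i) x \<le> q * tot d I K w x}"
  from assms have fin: "finite I" and "\<exists>x. 0 < qsum d K (w i) x" by (auto simp: represents_def)
  then obtain z where z: "0 < qsum d K (w i) z" by blast
  have tz: "0 < tot d I K w z"
    using z qsum_le_tot[OF fin assms(2), of d K w z] by linarith
  have one: "1 \<in> ?S" using qsum_le_tot[OF fin assms(2), of d K w] by simp
  have lb: "qsum d K (w i) x / tot d I K w x \<le> conf d I K w i" if "0 < tot d I K w x" for x
    unfolding conf_def
  proof (rule cInf_greatest)
    show "?S \<noteq> {}" using one by blast
  qed (use that in \<open>auto simp: divide_le_eq\<close>)
  have bdd: "bdd_below ?S"
    using tz by (intro bdd_belowI[of _ "qsum d K (w i) z / tot d I K w z"]) (auto simp: divide_le_eq)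
  show "qsum d K (w i) x \<le> conf d I K w i * tot d I K w x"
  proof (cases "tot d I K w x = 0")
    case True
    then show ?thesis using qsum_le_tot[OF fin assms(2), of d K w x] by simp
  next
    case False
    then have "0 < tot d I K w x" using tot_nonneg[of d I K w x] by simp
    with lb[OF this] show ?thesis by (simp add: divide_le_eq)
  qed
  show "conf d I K w i \<le> q" if "\<And>x. qsum d K (w i) x \<le> q * tot d I K w x"
    unfolding conf_def using that bdd by (intro cInf_lower) auto
  show "0 < conf d I K w i"
    using lb[OF tz] divide_pos_pos[OF z tz] by linarith
qed

lemma represents_avg:
  assumes "represents d I \<eta> \<rho> K w"
  shows "sform d (\<lambda>j k. avg_state d I \<eta> \<rho> $$ (j, k)) x x = complex_of_real (tot d I K w x)"
proof -
  have "sform d (\<lambda>j k. avg_state d I \<eta> \<rho> $$ (j, k)) x x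
      = sform d (\<lambda>j k. \<Sum>i\<in>I. gram d K (w i) $$ (j, k)) x x"
    using assms by (intro sform_cong) (simp add: avg_state_def msum_def represents_def)
  then show ?thesis by (simp add: sform_sum sform_gram tot_def)
qed

lemma represents_diff:
  assumes "represents d I \<eta> \<rho> K w" "i \<in> I"
  defines "D \<equiv> \<lambda>q. complex_of_real q \<cdot>\<^sub>m avg_state d I \<eta> \<rho> - complex_of_real (\<eta> i) \<cdot>\<^sub>m \<rho> i"
  shows "D q \<in> carrier_mat d d"
    and "sform d (\<lambda>j k. D q $$ (j, k)) x x = complex_of_real (q * tot d I K w x - qsum d K (w i) x)"
proof -
  have g: "complex_of_real (\<eta> i) \<cdot>\<^sub>m \<rho> i = gram d K (w i)"
    using assms by (simp add: represents_def)
  have a: "avg_state d I \<eta> \<rho> \<in> carrier_mat d d" by (simp add: avg_state_def msum_def)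
  show "D q \<in> carrier_mat d d" unfolding D_def g by (rule minus_carrier_mat[OF gram_carrier])
  have "sform d (\<lambda>j k. D q $$ (j, k)) x x
      = sform d (\<lambda>j k. complex_of_real q * avg_state d I \<eta> \<rho> $$ (j, k) - gram d K (w i) $$ (j, k)) x x"
    using a gram_carrier[of d K "w i"] by (intro sform_cong) (simp add: D_def g)
  then show "sform d (\<lambda>j k. D q $$ (j, k)) x x = complex_of_real (q * tot d I K w x - qsum d K (w i) x)"
    by (simp add: sform_diff sform_scale sform_gram represents_avg[OF assms(1)])
qed

lemma confidence_eq_conf:
  assumes "represents d I \<eta> \<rho> K w" "i \<in> I"
  shows "confidence d I \<eta> \<rho> i = conf d I K w i"
  unfolding confidence_def conf_def psd_iff_posf posf_def
  using represents_diff[OF assms] by simp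

lemma success_prob_gram:
  assumes "represents d I \<eta> \<rho> K w" "\<And>i. i \<in> I \<Longrightarrow> M i = gram d L (m i)"
  shows "success_prob I \<eta> \<rho> M = gain d I K w L m"
  unfolding success_prob_def gain_def
proof (rule sum.cong)
  fix i assume i: "i \<in> I"
  have g: "complex_of_real (\<eta> i) \<cdot>\<^sub>m \<rho> i = gram d K (w i)"
    using assms i by (simp add: represents_def)
  then have r: "\<rho> i \<in> carrier_mat d d" using gram_carrier[of d K "w i"]
    by (metis carrier_matD carrier_matI index_smult_mat(2,3))
  have "complex_of_real (\<eta> i) * sform d (\<lambda>j k. \<rho> i $$ (j, k)) x x = complex_of_real (qsum d K (w i) x)" for x
    unfolding sform_scale[symmetric] sform_gram[symmetric] g[symmetric] using r
    by (intro sform_cong) simp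
  then have "complex_of_real (\<eta> i) * mtrace (\<rho> i * M i) = complex_of_real (\<Sum>l\<in>L. qsum d K (w i) (m i l))"
    unfolding assms(2)[OF i] mtrace_mult_gram[OF r] sum_distrib_left of_real_sum by simp
  then have "Re (complex_of_real (\<eta> i) * mtrace (\<rho> i * M i)) = (\<Sum>l\<in>L. qsum d K (w i) (m i l))"
    by (metis Re_complex_of_real)
  then show "\<eta> i * Re (mtrace (\<rho> i * M i)) = (\<Sum>l\<in>L. qsum d K (w i) (m i l))" by simp
qed simp

lemma maxconf_trace_gram:
  assumes "represents d I \<eta> \<rho> K w" "i \<in> I" "N = gram d L a"
  shows "mtrace ((complex_of_real (confidence d I \<eta> \<rho> i) \<cdot>\<^sub>m avg_state d I \<eta> \<rho>
                      - complex_of_real (\<eta> i) \<cdot>\<^sub>m \<rho> i) * N)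
    = complex_of_real (\<Sum>l\<in>L. conf d I K w i * tot d I K w (a l) - qsum d K (w i) (a l))"
  unfolding assms(3) confidence_eq_conf[OF assms(1,2)] mtrace_mult_gram[OF represents_diff(1)[OF assms(1,2)]]
    represents_diff(2)[OF assms(1,2)] by simp

lemma sform_msum_gram:
  assumes "\<And>i. i \<in> I \<Longrightarrow> M i = gram d L (m i)"
  shows "sform d (\<lambda>j k. msum d I M $$ (j, k)) u u = complex_of_real (\<Sum>i\<in>I. qsum d L (m i) u)"
proof -
  have "sform d (\<lambda>j k. msum d I M $$ (j, k)) u u = sform d (\<lambda>j k. \<Sum>i\<in>I. gram d L (m i) $$ (j, k)) u u"
    using assms by (intro sform_cong) (simp add: msum_def)
  then show ?thesis by (simp add: sform_sum sform_gram)
qed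

lemma sform_one: "sform d (\<lambda>j k. 1\<^sub>m d $$ (j, k)) u u = complex_of_real (nsq d u)"
proof -
  have "sform d (\<lambda>j k. 1\<^sub>m d $$ (j, k)) u u = (\<Sum>i<d. \<Sum>j<d. if i = j then cnj (u i) * u j else 0)"
    unfolding sform_def by (intro sum.cong) auto
  then show ?thesis by (simp add: ip_self[symmetric] ip_def)
qed

text \<open>Cholesky supplies the vectors. By \<open>qsum_le_conf\<close> the trace condition is a
  vanishing sum of nonnegative terms, so each vector is tight; positivity of \<open>Mq\<close> gives
  the frame bound.\<close>

lemma maxconf_meas_imp_family:
  assumes "represents d I \<eta> \<rho> K w" "maxconf_meas d I \<eta> \<rho> Mq M"
  shows "\<exists>m :: 'i \<Rightarrow> nat \<Rightarrow> nat \<Rightarrow> complex.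
    tight d I K w {..<d} m \<and> frame_le d I {..<d} m 1 \<and> success_prob I \<eta> \<rho> M = gain d I K w {..<d} m"
proof -
  have povm: "psd d Mq" "\<And>i. i \<in> I \<Longrightarrow> psd d (M i)" "Mq + msum d I M = 1\<^sub>m d"
    using assms(2) by (auto simp: maxconf_meas_def povm_def)
  then have "\<forall>i\<in>I. \<exists>a :: nat \<Rightarrow> nat \<Rightarrow> complex. M i = gram d {..<d} a" by (blast intro: psd_imp_gram)
  then obtain m :: "'i \<Rightarrow> nat \<Rightarrow> nat \<Rightarrow> complex" where m: "\<And>i. i \<in> I \<Longrightarrow> M i = gram d {..<d} (m i)"
    by metis
  have "qsum d K (w i) (m i l) = conf d I K w i * tot d I K w (m i l)" if i: "i \<in> I" and l: "l \<in> {..<d}" for i l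
  proof -
    have "(\<Sum>l<d. conf d I K w i * tot d I K w (m i l) - qsum d K (w i) (m i l)) = 0"
      using maxconf_trace_gram[OF assms(1) i m[OF i]] assms(2) i
      by (simp add: maxconf_meas_def flip: of_real_sum of_real_mult of_real_diff)
    then show ?thesis
      using l qsum_le_conf[OF assms(1) i] by (subst (asm) sum_nonneg_eq_0_iff) auto
  qed
  moreover have "(\<Sum>i\<in>I. qsum d {..<d} (m i) u) \<le> 1 * nsq d u" for u
  proof -
    have c: "Mq \<in> carrier_mat d d" "msum d I M \<in> carrier_mat d d"
      using povm(1) by (auto simp: psd_def msum_def)
    have "complex_of_real (nsq d u) = sform d (\<lambda>j k. (Mq + msum d I M) $$ (j, k)) u u"
      by (simp add: sform_one povm(3))
    also have "\<dots> = sform d (\<lambda>j k. Mq $$ (j, k) + msum d I M $$ (j, k)) u u"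
      using c by (intro sform_cong) simp
    also have "\<dots> = sform d (\<lambda>j k. Mq $$ (j, k)) u u + complex_of_real (\<Sum>i\<in>I. qsum d {..<d} (m i) u)"
      using sform_msum_gram[where M = M and m = m and L = "{..<d}", OF m] by (simp add: sform_add)
    finally have "nsq d u = Re (sform d (\<lambda>j k. Mq $$ (j, k)) u u) + (\<Sum>i\<in>I. qsum d {..<d} (m i) u)"
      by (metis Re_complex_of_real plus_complex.sel(1))
    moreover have "0 \<le> Re (sform d (\<lambda>j k. Mq $$ (j, k)) u u)"
      using povm(1) by (simp add: psd_iff_posf posf_def)
    ultimately show ?thesis by simp
  qed
  ultimately show ?thesis
    using success_prob_gram[where M = M, OF assms(1) m] by (auto simp: tight_def frame_le_def)
qed

text \<open>The inconclusive operator is what the family leaves of the identity; the frame bound is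
  its positivity.\<close>

lemma family_imp_maxconf_meas:
  assumes "represents d I \<eta> \<rho> K w" "tight d I K w L m" "frame_le d I L m 1"
  shows "\<exists>Mq. maxconf_meas d I \<eta> \<rho> Mq (\<lambda>i. gram d L (m i))"
proof -
  let ?M = "\<lambda>i. gram d L (m i)"
  let ?Mq = "1\<^sub>m d - msum d I ?M"
  have c: "msum d I ?M \<in> carrier_mat d d" by (simp add: msum_def)
  have "sform d (\<lambda>j k. ?Mq $$ (j, k)) u u = complex_of_real (nsq d u - (\<Sum>i\<in>I. qsum d L (m i) u))" for u
  proof -
    have "sform d (\<lambda>j k. ?Mq $$ (j, k)) u u = sform d (\<lambda>j k. 1\<^sub>m d $$ (j, k) - msum d I ?M $$ (j, k)) u u"
      using c by (intro sform_cong) simp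
    then show ?thesis by (simp add: sform_diff sform_one sform_msum_gram)
  qed
  then have "psd d ?Mq" using minus_carrier_mat[OF c] assms(3) by (simp add: psd_iff_posf posf_def frame_le_def)
  moreover have "?Mq + msum d I ?M = 1\<^sub>m d" using c by auto
  ultimately have "povm d I ?Mq ?M" by (simp add: povm_def psd_gram)
  moreover have "\<forall>i\<in>I. mtrace ((complex_of_real (confidence d I \<eta> \<rho> i) \<cdot>\<^sub>m avg_state d I \<eta> \<rho>
      - complex_of_real (\<eta> i) \<cdot>\<^sub>m \<rho> i) * ?M i) = 0"
    using assms(2) by (simp add: maxconf_trace_gram[OF assms(1) _ refl] tight_def)
  ultimately have "maxconf_meas d I \<eta> \<rho> ?Mq ?M" by (simp add: maxconf_meas_def)
  then show ?thesis ..
qed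

text \<open>Exchanging the sums evaluates the measurement forms at the state vectors, where the
  frame bound applies. This crude bound keeps the supremum in \<open>pG\<close> finite.\<close>

lemma gain_le_of_frame:
  assumes "frame_le d I L m 1" "finite I"
  shows "gain d I K w L m \<le> (\<Sum>i\<in>I. \<Sum>k\<in>K. nsq d (w i k))"
  unfolding gain_def
proof (rule sum_mono)
  fix i assume i: "i \<in> I"
  have "(\<Sum>l\<in>L. qsum d K (w i) (m i l)) = (\<Sum>k\<in>K. qsum d L (m i) (w i k))"
    unfolding qsum_def by (subst sum.swap) (simp add: cmod_ip_commute)
  also have "\<dots> \<le> (\<Sum>k\<in>K. nsq d (w i k))"
  proof (rule sum_mono)
    fix k
    have "qsum d L (m i) (w i k) \<le> (\<Sum>j\<in>I. qsum d L (m j) (w i k))"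
      by (rule member_le_sum[OF i]) (simp_all add: qsum_nonneg assms(2))
    also have "\<dots> \<le> 1 * nsq d (w i k)"
      using assms(1) unfolding frame_le_def by blast
    finally show "qsum d L (m i) (w i k) \<le> nsq d (w i k)" by simp
  qed
  finally show "(\<Sum>l\<in>L. qsum d K (w i) (m i l)) \<le> (\<Sum>k\<in>K. nsq d (w i k))" .
qed

lemma pG_le:
  assumes "represents d I \<eta> \<rho> K w"
    and "\<And>m :: 'i \<Rightarrow> nat \<Rightarrow> nat \<Rightarrow> complex. tight d I K w {..<d} m \<Longrightarrow> frame_le d I {..<d} m 1 \<Longrightarrow>
           gain d I K w {..<d} m \<le> p"
  shows "pG d I \<eta> \<rho> \<le> p"
  unfolding pG_def
proof (rule cSup_least)
  \<comment> \<open>The empty family, a measurement that is always inconclusive, shows that the set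
    of success values is nonempty.\<close>
  have "tight d I K w ({} :: nat set) (\<lambda>_ _ _. 0)" "frame_le d I ({} :: nat set) (\<lambda>_ _ _. 0) 1"
    by (simp_all add: tight_def frame_le_def qsum_def nsq_nonneg)
  then show "{success_prob I \<eta> \<rho> M |Mq M. maxconf_meas d I \<eta> \<rho> Mq M} \<noteq> {}"
    using family_imp_maxconf_meas[OF assms(1)] by blast
  fix v assume "v \<in> {success_prob I \<eta> \<rho> M |Mq M. maxconf_meas d I \<eta> \<rho> Mq M}"
  then show "v \<le> p" using maxconf_meas_imp_family[OF assms(1)] assms(2) by fastforce
qed

text \<open>Rescaling all vectors by \<open>1 / sqrt c\<close> turns the bound \<open>c\<close> into
  1, keeps tightness and divides the gain by \<open>c\<close>. General \<open>c\<close>, zero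
  included, serves contracted families, whose bound is the squared norm of the contracting
  vector.\<close>

lemma gain_le_pG:
  assumes r: "represents d I \<eta> \<rho> K w" and t: "tight d I K w L m" and f: "frame_le d I L m c"
    and c: "0 \<le> c" and L: "finite L"
  shows "gain d I K w L m \<le> c * pG d I \<eta> \<rho>"
proof (cases "c = 0")
  case True
  have "m i l s = 0" if "i \<in> I" "l \<in> L" "s < d" for i l s
  proof -
    \<comment> \<open>Testing the bound on a vector of the family itself shows that the fourth power
      of its norm is at most zero.\<close>
    have "(cmod (ip d (m i l) (m i l)))\<^sup>2 \<le> qsum d L (m i) (m i l)"
      unfolding qsum_def using that L member_le_sum[of l L "\<lambda>k. (cmod (ip d (m i k) (m i l)))\<^sup>2"] by simp
    also have "\<dots> \<le> (\<Sum>j\<in>I. qsum d L (m j) (m i l))"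
      using that r member_le_sum[of i I "\<lambda>j. qsum d L (m j) (m i l)"]
      by (simp add: qsum_nonneg represents_def)
    also have "\<dots> \<le> 0" using f True by (simp add: frame_le_def)
    finally have "nsq d (m i l) = 0" by (simp add: ip_self)
    then show ?thesis using that(3) by (simp add: nsq_def sum_nonneg_eq_0_iff)
  qed
  then have "qsum d K (w i) (m i l) = 0" if "i \<in> I" "l \<in> L" for i l
    using that by (simp add: qsum_def ip_def)
  then show ?thesis using True by (simp add: gain_def)
next
  case False
  with c have c: "0 < c" by simp
  define m' where "m' = (\<lambda>i l s. complex_of_real (1 / sqrt c) * m i l s)"
  have sq: "(cmod (complex_of_real (1 / sqrt c)))\<^sup>2 = 1 / c"
    using c by (simp add: norm_divide power_divide)
  have "tight d I K w L m'"
    using t unfolding tight_def m'_def qsum_scale tot_scale by simp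
  moreover have "frame_le d I L m' 1"
  proof -
    have "qsum d L (m' i) u = (1 / c) * qsum d L (m i) u" for i u
      unfolding qsum_def m'_def ip_linear norm_mult power_mult_distrib complex_mod_cnj sq
      by (simp add: sum_divide_distrib)
    then show ?thesis using f c by (simp add: frame_le_def divide_le_eq mult.commute flip: sum_divide_distrib)
  qed
  moreover have "bdd_above {success_prob I \<eta> \<rho> M |Mq M. maxconf_meas d I \<eta> \<rho> Mq M}"
  proof (rule bdd_aboveI)
    fix v assume "v \<in> {success_prob I \<eta> \<rho> M |Mq M. maxconf_meas d I \<eta> \<rho> Mq M}"
    then show "v \<le> (\<Sum>i\<in>I. \<Sum>k\<in>K. nsq d (w i k))"
      using maxconf_meas_imp_family[OF r] gain_le_of_frame r unfolding represents_def by fastforce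
  qed
  moreover have "success_prob I \<eta> \<rho> (\<lambda>i. gram d L (m' i)) = gain d I K w L m'"
    using r by (rule success_prob_gram) simp
  ultimately have "gain d I K w L m' \<le> pG d I \<eta> \<rho>"
    using family_imp_maxconf_meas[OF r, of L m'] unfolding pG_def by (intro cSup_upper) (auto, metis)
  moreover have "gain d I K w L m' = (1 / c) * gain d I K w L m"
    unfolding gain_def m'_def qsum_scale sq sum_distrib_left ..
  ultimately show ?thesis using c by (simp add: divide_le_eq mult.commute)
qed

subsection \<open>Tensor products and partial contractions\<close>

definition tens :: "nat \<Rightarrow> (nat \<Rightarrow> complex) \<Rightarrow> (nat \<Rightarrow> complex) \<Rightarrow> nat \<Rightarrow> complex" where
  "tens e a b i = a (i div e) * b (i mod e)"

text \<open>The partial inner product \<open>(1 \<otimes> \<langle>b|) m\<close>, a vector of the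
  first factor.\<close>

definition conR :: "nat \<Rightarrow> (nat \<Rightarrow> complex) \<Rightarrow> (nat \<Rightarrow> complex) \<Rightarrow> nat \<Rightarrow> complex" where
  "conR e b m s = (\<Sum>t<e. cnj (b t) * m (s * e + t))"

text \<open>The partial inner product \<open>(\<langle>a| \<otimes> 1) m\<close>, a vector of the
  second factor, antilinear in \<open>a\<close>.\<close>

definition conL :: "nat \<Rightarrow> nat \<Rightarrow> (nat \<Rightarrow> complex) \<Rightarrow> (nat \<Rightarrow> complex) \<Rightarrow> nat \<Rightarrow> complex" where
  "conL d e a m t = (\<Sum>s<d. cnj (a s) * m (s * e + t))"

definition tfam :: "nat \<Rightarrow> ('k \<Rightarrow> nat \<Rightarrow> complex) \<Rightarrow> ('l \<Rightarrow> nat \<Rightarrow> complex) \<Rightarrow> 'k \<times> 'l \<Rightarrow> nat \<Rightarrow> complex" where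
  "tfam e a b = (\<lambda>(k, l). tens e (a k) (b l))"

lemma sum_lessThan_mult:
  fixes f :: "nat \<Rightarrow> 'a :: comm_monoid_add"
  shows "(\<Sum>i<d * e. f i) = (\<Sum>s<d. \<Sum>t<e. f (s * e + t))"
proof -
  have "sum f {s * e..<s * e + e} = (\<Sum>t<e. f (s * e + t))" for s
    by (rule sum.reindex_bij_witness[of _ "\<lambda>t. s * e + t" "\<lambda>i. i - s * e"]) auto
  then show ?thesis by (simp only: sum.nat_group[symmetric])
qed

lemma sum_Times: "(\<Sum>x\<in>A \<times> B. f x) = (\<Sum>a\<in>A. \<Sum>b\<in>B. f (a, b))"
  by (simp add: sum.cartesian_product)

lemma ip_tens_conR: "ip (d * e) (tens e a b) m = ip d a (conR e b m)"
  unfolding ip_def sum_lessThan_mult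
  by (auto simp: tens_def conR_def sum_distrib_left mult.assoc intro!: sum.cong)

lemma ip_tens_conL: "ip (d * e) (tens e a b) m = ip e b (conL d e a m)"
  unfolding ip_def sum_lessThan_mult
  by (subst sum.swap) (auto simp: tens_def conL_def sum_distrib_left mult_ac intro!: sum.cong)

lemma nsq_slices: "(\<Sum>s<d. nsq e (\<lambda>t. m (s * e + t))) = nsq (d * e) m"
  by (simp add: nsq_def sum_lessThan_mult)

lemma nsq_tens: "nsq (d * e) (tens e a b) = nsq d a * nsq e b"
  unfolding nsq_def sum_lessThan_mult sum_product
  by (auto simp: tens_def norm_mult power_mult_distrib intro!: sum.cong)

lemma ip_tens_tens: "ip (d * e) (tens e a b) (tens e x y) = ip d a x * ip e b y"
  unfolding ip_def sum_lessThan_mult sum_product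
  by (auto simp: tens_def intro!: sum.cong)

lemma nsq_conR: "nsq d (conR e b m) = (\<Sum>s<d. (cmod (ip e b (\<lambda>t. m (s * e + t))))\<^sup>2)"
  by (simp add: nsq_def conR_def ip_def)

lemma conL_zero: "conL d e (\<lambda>i. 0) m = (\<lambda>t. 0)"
  by (simp add: conL_def fun_eq_iff)

lemma conL_add_scale: "conL d e (\<lambda>i. a i + c * b i) m = (\<lambda>t. conL d e a m t + cnj c * conL d e b m t)"
  by (simp add: conL_def fun_eq_iff algebra_simps sum.distrib sum_distrib_left)

text \<open>A product form is a sum of forms of one factor at contracted vectors; this reduces
  inequalities on the product to inequalities on a factor.\<close>

lemma qsum_tfam_conR: "qsum (d * e) (K \<times> L) (tfam e a b) m = (\<Sum>l\<in>L. qsum d K a (conR e (b l) m))"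
  unfolding qsum_def tfam_def
  by (subst sum.swap) (simp add: sum.cartesian_product case_prod_unfold ip_tens_conR)

lemma qsum_tfam_conL: "qsum (d * e) (K \<times> L) (tfam e a b) m = (\<Sum>k\<in>K. qsum e L b (conL d e (a k) m))"
  unfolding qsum_def tfam_def
  by (simp add: sum.cartesian_product case_prod_unfold ip_tens_conL)

lemma qsum_tfam_tens: "qsum (d * e) (K \<times> L) (tfam e a b) (tens e x y) = qsum d K a x * qsum e L b y"
  unfolding qsum_def tfam_def sum_product
  by (simp add: sum.cartesian_product case_prod_unfold ip_tens_tens norm_mult power_mult_distrib)

text \<open>Both sides are the modulus of the overlap of \<open>m\<close> with
  \<open>u \<otimes> b\<close>.\<close>

lemma cmod_ip_conR: "cmod (ip d (conR e b m) u) = cmod (ip e b (conL d e u m))"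
  by (metis cmod_ip_commute ip_tens_conL ip_tens_conR)

lemma cmod_ip_conL: "cmod (ip e (conL d e u m) y) = cmod (ip (d * e) m (tens e u y))"
  by (metis cmod_ip_commute ip_tens_conL)

lemma kron_smult: "(c * c') \<cdot>\<^sub>m kron A B = kron (c \<cdot>\<^sub>m A) (c' \<cdot>\<^sub>m B)"
proof (rule eq_matI)
  fix i j assume "i < dim_row (kron (c \<cdot>\<^sub>m A) (c' \<cdot>\<^sub>m B))" "j < dim_col (kron (c \<cdot>\<^sub>m A) (c' \<cdot>\<^sub>m B))"
  then have ij: "i < dim_row A * dim_row B" "j < dim_col A * dim_col B" by (auto simp: kron_def)
  then have "0 < dim_row B" "0 < dim_col B" by (auto intro: Nat.gr0I)
  with ij show "((c * c') \<cdot>\<^sub>m kron A B) $$ (i, j) = kron (c \<cdot>\<^sub>m A) (c' \<cdot>\<^sub>m B) $$ (i, j)"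
    by (simp add: kron_def less_mult_imp_div_less)
qed (simp_all add: kron_def)

lemma kron_gram: "kron (gram d K a) (gram e L b) = gram (d * e) (K \<times> L) (tfam e a b)"
proof (rule eq_matI)
  fix i j assume "i < dim_row (gram (d * e) (K \<times> L) (tfam e a b))" "j < dim_col (gram (d * e) (K \<times> L) (tfam e a b))"
  then have ij: "i < d * e" "j < d * e" by (auto simp: gram_def)
  then have "0 < e" by (auto intro: Nat.gr0I)
  with ij show "kron (gram d K a) (gram e L b) $$ (i, j) = gram (d * e) (K \<times> L) (tfam e a b) $$ (i, j)"
    by (simp add: kron_def gram_def tfam_def tens_def less_mult_imp_div_less sum_product
        sum.cartesian_product case_prod_unfold mult_ac)
qed (simp_all add: kron_def gram_def)

lemma psd_kron: "psd d A \<Longrightarrow> psd e B \<Longrightarrow> psd (d * e) (kron A B)"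
  by (metis kron_gram psd_gram psd_imp_gram)

lemma mtrace_kron:
  assumes "dim_col A = dim_row A" "dim_col B = dim_row B"
  shows "mtrace (kron A B) = mtrace A * mtrace B"
proof -
  have "mtrace (kron A B) = (\<Sum>i<dim_row A * dim_row B.
      A $$ (i div dim_row B, i div dim_row B) * B $$ (i mod dim_row B, i mod dim_row B))"
    unfolding mtrace_def using assms by (auto simp: kron_def intro!: sum.cong)
  then show ?thesis
    unfolding sum_lessThan_mult mtrace_def sum_product by (auto intro!: sum.cong)
qed

lemma density_kron: "density d A \<Longrightarrow> density e B \<Longrightarrow> density (d * e) (kron A B)"
  using psd_kron[of d A e B] mtrace_kron[of A B] by (auto simp: density_def psd_iff_posf)

lemma ensemble_represents:
  assumes "ensemble d I \<eta> \<rho>"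
  shows "\<exists>w :: 'i \<Rightarrow> nat \<Rightarrow> nat \<Rightarrow> complex. represents d I \<eta> \<rho> {..<d} w"
proof -
  have e: "finite I" "\<And>i. i \<in> I \<Longrightarrow> 0 < \<eta> i" "\<And>i. i \<in> I \<Longrightarrow> psd d (\<rho> i)"
    "\<And>i. i \<in> I \<Longrightarrow> mtrace (\<rho> i) = 1"
    using assms by (auto simp: ensemble_def density_def)
  have "\<exists>a :: nat \<Rightarrow> nat \<Rightarrow> complex. complex_of_real (\<eta> i) \<cdot>\<^sub>m \<rho> i = gram d {..<d} a" if i: "i \<in> I" for i
  proof (rule psd_imp_gram)
    have c: "\<rho> i \<in> carrier_mat d d" using e(3)[OF i] by (simp add: psd_def)
    have "sform d (\<lambda>j k. (complex_of_real (\<eta> i) \<cdot>\<^sub>m \<rho> i) $$ (j, k)) x x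
        = complex_of_real (\<eta> i) * sform d (\<lambda>j k. \<rho> i $$ (j, k)) x x" for x
      unfolding sform_scale[symmetric] using c by (intro sform_cong) simp
    with e(2,3)[OF i] show "psd d (complex_of_real (\<eta> i) \<cdot>\<^sub>m \<rho> i)"
      by (simp add: psd_iff_posf posf_def)
  qed
  then obtain w :: "'i \<Rightarrow> nat \<Rightarrow> nat \<Rightarrow> complex" where
    w: "\<And>i. i \<in> I \<Longrightarrow> complex_of_real (\<eta> i) \<cdot>\<^sub>m \<rho> i = gram d {..<d} (w i)"
    by metis
  have "\<exists>x. 0 < qsum d {..<d} (w i) x" if i: "i \<in> I" for i
  proof (rule ccontr)
    assume "\<nexists>x. 0 < qsum d {..<d} (w i) x"
    then have z: "qsum d {..<d} (w i) x = 0" for x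
      using qsum_nonneg[of d "{..<d}" "w i" x] by (metis less_eq_real_def)
    have c: "\<rho> i \<in> carrier_mat d d" using e(3)[OF i] by (simp add: psd_def)
    \<comment> \<open>Diagonal entries are values of the form at basis vectors; were the form zero,
      the trace would vanish instead of being 1.\<close>
    have "\<rho> i $$ (s, s) = 0" if "s < d" for s
    proof -
      have "complex_of_real (\<eta> i) * \<rho> i $$ (s, s) = gram d {..<d} (w i) $$ (s, s)"
        using that c by (simp flip: w[OF i])
      also have "\<dots> = sform d (\<lambda>j k. gram d {..<d} (w i) $$ (j, k)) (uvec s) (uvec s)"
        using that by (simp add: sform_uvec)
      also have "\<dots> = 0" by (simp add: sform_gram z)
      finally show ?thesis using e(2)[OF i] by simp
    qed
    then have "mtrace (\<rho> i) = 0" using c by (simp add: mtrace_def)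
    then show False using e(4)[OF i] by simp
  qed
  with w e(1) have "represents d I \<eta> \<rho> {..<d} w" by (simp add: represents_def)
  then show ?thesis by blast
qed

subsection \<open>The product of two ensembles\<close>

text \<open>The product is indexed by any set in bijection with \<open>I \<times> J\<close>, so that
  index sequences extended by one component fit as well as pairs.\<close>

locale ensemble_pair =
  fixes d :: nat and I :: "'i set" and \<eta> :: "'i \<Rightarrow> real" and \<rho> :: "'i \<Rightarrow> complex mat"
    and K :: "'k set" and w :: "'i \<Rightarrow> 'k \<Rightarrow> nat \<Rightarrow> complex"
    and e :: nat and J :: "'j set" and \<mu> :: "'j \<Rightarrow> real" and \<sigma> :: "'j \<Rightarrow> complex mat"
    and L :: "'l set" and v :: "'j \<Rightarrow> 'l \<Rightarrow> nat \<Rightarrow> complex"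
    and X :: "'x set" and g :: "'x \<Rightarrow> 'i \<times> 'j"
  assumes r1: "represents d I \<eta> \<rho> K w" and r2: "represents e J \<mu> \<sigma> L v"
    and bij: "bij_betw g X (I \<times> J)"
begin

definition "\<eta>p x = \<eta> (fst (g x)) * \<mu> (snd (g x))"
definition "\<rho>p x = kron (\<rho> (fst (g x))) (\<sigma> (snd (g x)))"
definition "wp x = tfam e (w (fst (g x))) (v (snd (g x)))"

lemma fins: "finite I" "finite J" "finite K" "finite L"
  using r1 r2 by (auto simp: represents_def)

lemma sum_X: "(\<Sum>x\<in>X. F (fst (g x)) (snd (g x))) = (\<Sum>i\<in>I. \<Sum>j\<in>J. F i j)"
  using sum.reindex_bij_betw[OF bij, of "\<lambda>(i, j). F i j"]
  by (simp add: sum.cartesian_product case_prod_unfold)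

lemma g_mem: "x \<in> X \<Longrightarrow> fst (g x) \<in> I" "x \<in> X \<Longrightarrow> snd (g x) \<in> J"
  using bij_betw_apply[OF bij, of x] by (auto simp: mem_Times_iff)

lemma g_surj: "i \<in> I \<Longrightarrow> j \<in> J \<Longrightarrow> \<exists>x\<in>X. g x = (i, j)"
  using bij by (auto simp: bij_betw_def set_eq_iff image_iff) metis

lemma represents_product: "represents (d * e) X \<eta>p \<rho>p (K \<times> L) wp"
proof -
  have "finite X" using bij_betw_finite[OF bij] fins by simp
  moreover have "complex_of_real (\<eta>p x) \<cdot>\<^sub>m \<rho>p x = gram (d * e) (K \<times> L) (wp x)" if "x \<in> X" for x
    using r1 r2 g_mem[OF that]
    by (simp add: \<eta>p_def \<rho>p_def wp_def kron_smult represents_def kron_gram)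
  moreover have "\<exists>z. 0 < qsum (d * e) (K \<times> L) (wp x) z" if x: "x \<in> X" for x
  proof -
    obtain a b where "0 < qsum d K (w (fst (g x))) a" "0 < qsum e L (v (snd (g x))) b"
      using r1 r2 g_mem[OF x] unfolding represents_def by blast
    then have "0 < qsum (d * e) (K \<times> L) (wp x) (tens e a b)"
      by (simp add: wp_def qsum_tfam_tens)
    then show ?thesis by blast
  qed
  ultimately show ?thesis using fins by (simp add: represents_def)
qed

abbreviation "C \<equiv> conf d I K w"
abbreviation "D \<equiv> conf e J L v"
abbreviation "Cp \<equiv> conf (d * e) X (K \<times> L) wp"
abbreviation "totp \<equiv> tot (d * e) X (K \<times> L) wp"
abbreviation "both i j \<equiv> qsum (d * e) (K \<times> L) (tfam e (w i) (v j))"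

text \<open>The form of the average state of the first factor tensored with the unnormalised j-th state
  of the second one.\<close>

definition "mid j m = (\<Sum>i\<in>I. both i j m)"

lemma mid_conR: "mid j m = (\<Sum>l\<in>L. tot d I K w (conR e (v j l) m))"
  unfolding mid_def tot_def qsum_tfam_conR by (rule sum.swap)

lemma mid_conL: "mid j m = (\<Sum>i\<in>I. \<Sum>k\<in>K. qsum e L (v j) (conL d e (w i k) m))"
  unfolding mid_def qsum_tfam_conL ..

lemma totp_eq: "totp m = (\<Sum>i\<in>I. \<Sum>j\<in>J. both i j m)"
  unfolding tot_def wp_def sum_X[of "\<lambda>i j. both i j m"] ..

lemma totp_conL: "totp m = (\<Sum>i\<in>I. \<Sum>k\<in>K. tot e J L v (conL d e (w i k) m))"
proof -
  have "totp m = (\<Sum>i\<in>I. \<Sum>j\<in>J. \<Sum>k\<in>K. qsum e L (v j) (conL d e (w i k) m))"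
    by (simp only: totp_eq qsum_tfam_conL)
  also have "\<dots> = (\<Sum>i\<in>I. \<Sum>k\<in>K. \<Sum>j\<in>J. qsum e L (v j) (conL d e (w i k) m))"
    by (rule sum.cong[OF refl], rule sum.swap)
  finally show ?thesis by (simp only: tot_def)
qed

lemma totp_tens: "totp (tens e a b) = tot d I K w a * tot e J L v b"
  by (simp only: totp_eq qsum_tfam_tens) (simp only: tot_def sum_product)

text \<open>Contracting the second factor with the vectors \<open>v j l\<close> leaves a sum of
  forms on the first, and the confidence inequality of the first ensemble applies to each
  term.\<close>

lemma both_le_mid:
  assumes "i \<in> I"
  shows "both i j m \<le> C i * mid j m"
  unfolding qsum_tfam_conR mid_conR sum_distrib_left
  by (intro sum_mono qsum_le_conf[OF r1 assms])

text \<open>The same with the roles of the factors exchanged, contracting with the vectors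
  \<open>w i k\<close>.\<close>

lemma mid_le_totp:
  assumes "j \<in> J"
  shows "mid j m \<le> D j * totp m"
  unfolding mid_conL totp_conL sum_distrib_left
  by (intro sum_mono qsum_le_conf[OF r2 assms])

text \<open>The upper bound chains the two inequalities through \<open>mid\<close>. The lower bound
  tests on product vectors, where all forms factor.\<close>

lemma conf_product:
  assumes x: "x \<in> X"
  shows "Cp x = C (fst (g x)) * D (snd (g x))"
proof (rule antisym)
  let ?i = "fst (g x)" and ?j = "snd (g x)"
  have i: "?i \<in> I" and j: "?j \<in> J" using g_mem[OF x] .
  have C: "0 < C ?i" using conf_pos[OF r1 i] .
  show "Cp x \<le> C ?i * D ?j"
  proof (rule conf_le[OF represents_product x])
    fix m
    have "both ?i ?j m \<le> C ?i * mid ?j m" using i by (rule both_le_mid)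
    also have "\<dots> \<le> C ?i * (D ?j * totp m)"
      using C mid_le_totp[OF j] by (intro mult_left_mono) simp_all
    finally show "qsum (d * e) (K \<times> L) (wp x) m \<le> C ?i * D ?j * totp m"
      by (simp add: wp_def mult.assoc)
  qed
  have prod: "qsum d K (w ?i) a * qsum e L (v ?j) b \<le> Cp x * (tot d I K w a * tot e J L v b)" for a b
    using qsum_le_conf[OF represents_product x, of "tens e a b"]
    by (simp add: wp_def qsum_tfam_tens totp_tens)
  \<comment> \<open>For fixed \<open>b\<close>, the inequality \<open>prod\<close> makes
    \<open>Cp * tot / qsum\<close> admissible for \<open>C\<close>; solving the resulting bound on
    \<open>C\<close> for \<open>qsum\<close> makes \<open>Cp / C\<close> admissible for
    \<open>D\<close>.\<close>
  have "D ?j \<le> Cp x / C ?i"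
  proof (rule conf_le[OF r2 j])
    fix b
    show "qsum e L (v ?j) b \<le> Cp x / C ?i * tot e J L v b"
    proof (cases "qsum e L (v ?j) b = 0")
      case True
      then show ?thesis
        using C conf_pos[OF represents_product x] tot_nonneg[of e J L v b] by simp
    next
      case False
      then have pos: "0 < qsum e L (v ?j) b" using qsum_nonneg[of e L "v ?j" b] by simp
      have "C ?i \<le> Cp x * tot e J L v b / qsum e L (v ?j) b"
      proof (rule conf_le[OF r1 i])
        fix a
        show "qsum d K (w ?i) a \<le> Cp x * tot e J L v b / qsum e L (v ?j) b * tot d I K w a"
          using prod[of a b] pos by (simp add: field_simps)
      qed
      with pos C show ?thesis by (simp add: field_simps)
    qed
  qed
  with C show "C ?i * D ?j \<le> Cp x" by (simp add: field_simps)
qed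

text \<open>The product measurement: tightness and gain factor because its vectors are tensor
  products.\<close>

lemma gain_mult_le:
  assumes m: "tight d I K w P m" "frame_le d I P m 1" and n: "tight e J L v Q n" "frame_le e J Q n 1"
    and fin: "finite P" "finite Q"
  shows "gain d I K w P m * gain e J L v Q n \<le> pG (d * e) X \<eta>p \<rho>p"
proof -
  define mn where "mn x = tfam e (m (fst (g x))) (n (snd (g x)))" for x
  have "tight (d * e) X (K \<times> L) wp (P \<times> Q) mn"
    unfolding tight_def mn_def using m(1) n(1) g_mem
    by (auto simp: tfam_def[of _ "m _"] wp_def qsum_tfam_tens totp_tens conf_product tight_def)
  moreover have "frame_le (d * e) X (P \<times> Q) mn 1"
    unfolding frame_le_def
  proof
    fix u
    have "(\<Sum>x\<in>X. qsum (d * e) (P \<times> Q) (mn x) u)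
        = (\<Sum>i\<in>I. \<Sum>j\<in>J. qsum (d * e) (P \<times> Q) (tfam e (m i) (n j)) u)"
      unfolding mn_def by (rule sum_X)
    also have "\<dots> = (\<Sum>i\<in>I. \<Sum>j\<in>J. \<Sum>q\<in>Q. qsum d P (m i) (conR e (n j q) u))"
      by (simp only: qsum_tfam_conR)
    also have "\<dots> = (\<Sum>j\<in>J. \<Sum>q\<in>Q. \<Sum>i\<in>I. qsum d P (m i) (conR e (n j q) u))"
      by (subst sum.swap, rule sum.cong[OF refl], rule sum.swap)
    \<comment> \<open>The bound of \<open>m\<close> acts on the contracted vectors; what remains are
      overlaps of \<open>n\<close> with the slices of \<open>u\<close>, to which the bound of
      \<open>n\<close> applies.\<close>
    also have "\<dots> \<le> (\<Sum>j\<in>J. \<Sum>q\<in>Q. nsq d (conR e (n j q) u))"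
      using m(2) by (intro sum_mono) (simp add: frame_le_def)
    also have "\<dots> = (\<Sum>j\<in>J. \<Sum>s<d. qsum e Q (n j) (\<lambda>t. u (s * e + t)))"
      unfolding nsq_conR qsum_def by (rule sum.cong[OF refl], rule sum.swap)
    also have "\<dots> = (\<Sum>s<d. \<Sum>j\<in>J. qsum e Q (n j) (\<lambda>t. u (s * e + t)))"
      by (rule sum.swap)
    also have "\<dots> \<le> (\<Sum>s<d. nsq e (\<lambda>t. u (s * e + t)))"
      using n(2) by (intro sum_mono) (simp add: frame_le_def)
    finally show "(\<Sum>x\<in>X. qsum (d * e) (P \<times> Q) (mn x) u) \<le> 1 * nsq (d * e) u"
      by (simp add: nsq_slices)
  qed
  ultimately have "gain (d * e) X (K \<times> L) wp (P \<times> Q) mn \<le> 1 * pG (d * e) X \<eta>p \<rho>p"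
    using fin by (intro gain_le_pG[OF represents_product]) simp_all
  moreover have "gain (d * e) X (K \<times> L) wp (P \<times> Q) mn = gain d I K w P m * gain e J L v Q n"
  proof -
    have "gain (d * e) X (K \<times> L) wp (P \<times> Q) mn
        = (\<Sum>i\<in>I. \<Sum>j\<in>J. \<Sum>pq\<in>P \<times> Q. both i j (tfam e (m i) (n j) pq))"
      unfolding gain_def mn_def wp_def sum_X[of "\<lambda>i j. \<Sum>pq\<in>P \<times> Q. both i j (tfam e (m i) (n j) pq)"] ..
    also have "\<dots> = (\<Sum>i\<in>I. \<Sum>j\<in>J. (\<Sum>p\<in>P. qsum d K (w i) (m i p)) * (\<Sum>q\<in>Q. qsum e L (v j) (n j q)))"
      by (simp add: tfam_def[of _ "m _"] qsum_tfam_tens sum_product sum.cartesian_product case_prod_unfold)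
    finally show ?thesis by (simp add: gain_def sum_product)
  qed
  ultimately show ?thesis by simp
qed

lemma pG_nonneg: "represents d' I' \<eta>' \<rho>' K' w' \<Longrightarrow> 0 \<le> pG d' I' \<eta>' \<rho>'"
  using gain_le_pG[of d' I' \<eta>' \<rho>' K' w' "{} :: nat set" "\<lambda>_ _ _. 0" 1]
  by (simp add: tight_def frame_le_def gain_def qsum_def nsq_nonneg)

text \<open>With one family fixed, divide by its gain and pass to the supremum over the other, then
  repeat for the fixed one. Zero factors, which cannot be divided by, are covered by
  nonnegativity.\<close>

lemma pG_mult_le: "pG d I \<eta> \<rho> * pG e J \<mu> \<sigma> \<le> pG (d * e) X \<eta>p \<rho>p"
proof -
  let ?p = "pG d I \<eta> \<rho>" and ?q = "pG e J \<mu> \<sigma>" and ?r = "pG (d * e) X \<eta>p \<rho>p"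
  have nn: "0 \<le> ?p" "0 \<le> ?q" "0 \<le> ?r"
    by (rule pG_nonneg[OF r1] pG_nonneg[OF r2] pG_nonneg[OF represents_product])+
  have *: "?p * gain e J L v {..<e} n \<le> ?r"
    if "tight e J L v {..<e} n" "frame_le e J {..<e} n 1" for n :: "'j \<Rightarrow> nat \<Rightarrow> nat \<Rightarrow> complex"
  proof (cases "gain e J L v {..<e} n = 0")
    case False
    then have pos: "0 < gain e J L v {..<e} n" using gain_nonneg[of e J L v "{..<e}" n] by simp
    have "?p \<le> ?r / gain e J L v {..<e} n"
      using gain_mult_le[where P = "{..<d}", OF _ _ that] pos by (intro pG_le[OF r1]) (simp add: le_divide_eq)
    with pos show ?thesis by (simp add: le_divide_eq)
  qed (use nn in simp)
  show ?thesis
  proof (cases "?p = 0")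
    case False
    with nn have pos: "0 < ?p" by simp
    have "?q \<le> ?r / ?p"
      using * pos by (intro pG_le[OF r2]) (simp add: le_divide_eq mult.commute)
    with pos show ?thesis by (simp add: le_divide_eq mult.commute)
  qed (use nn in simp)
qed

text \<open>Equality between the ends of \<open>both \<le> C * mid \<le> C * D * totp\<close> forces
  equality in both links, then term by term. The second link sums over the whole first ensemble, so
  the second claim holds for every \<open>i'\<close>, not just for \<open>i\<close>.\<close>

lemma tight_product:
  assumes "i \<in> I" "j \<in> J" "both i j m = C i * D j * totp m"
  shows "l \<in> L \<Longrightarrow> qsum d K (w i) (conR e (v j l) m) = C i * tot d I K w (conR e (v j l) m)"
    and "i' \<in> I \<Longrightarrow> k \<in> K \<Longrightarrow>
      qsum e L (v j) (conL d e (w i' k) m) = D j * tot e J L v (conL d e (w i' k) m)"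
proof -
  have C: "0 < C i" using conf_pos[OF r1 assms(1)] .
  have le1: "both i j m \<le> C i * mid j m" using assms(1) by (rule both_le_mid)
  have "C i * mid j m \<le> C i * (D j * totp m)"
    using C mid_le_totp[OF assms(2)] by (intro mult_left_mono) simp_all
  moreover have "both i j m = C i * (D j * totp m)" using assms(3) by (simp add: mult.assoc)
  ultimately have eq1: "both i j m = C i * mid j m" and "C i * mid j m = C i * (D j * totp m)"
    using le1 by linarith+
  with C have eq2: "mid j m = D j * totp m" by auto
  show "qsum d K (w i) (conR e (v j l) m) = C i * tot d I K w (conR e (v j l) m)" if "l \<in> L"
  proof -
    have "(\<Sum>l\<in>L. C i * tot d I K w (conR e (v j l) m) - qsum d K (w i) (conR e (v j l) m)) = 0"
      using eq1 by (simp add: qsum_tfam_conR mid_conR sum_subtractf sum_distrib_left)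
    then show ?thesis
      using that fins qsum_le_conf[OF r1 assms(1)] by (subst (asm) sum_nonneg_eq_0_iff) auto
  qed
  show "qsum e L (v j) (conL d e (w i' k) m) = D j * tot e J L v (conL d e (w i' k) m)"
    if "i' \<in> I" "k \<in> K"
  proof -
    have "(\<Sum>(i, k)\<in>I \<times> K. D j * tot e J L v (conL d e (w i k) m) - qsum e L (v j) (conL d e (w i k) m)) = 0"
      using eq2 by (simp add: mid_conL totp_conL sum_subtractf sum_distrib_left sum_Times)
    then show ?thesis
      using that fins qsum_le_conf[OF r2 assms(2)] by (subst (asm) sum_nonneg_eq_0_iff) auto
  qed
qed

text \<open>Equality in the confidence inequality says that a vector lies in the kernel of a positive
  semidefinite form; by the parallelogram law such vectors are closed under addition.\<close>

lemma tight_cspan: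
  assumes j: "j \<in> J" and u: "u \<in> cspan B"
    and B: "\<And>b. b \<in> B \<Longrightarrow> qsum e L (v j) (conL d e b m) = D j * tot e J L v (conL d e b m)"
  shows "qsum e L (v j) (conL d e u m) = D j * tot e J L v (conL d e u m)"
  using u
proof (induction rule: cspan.induct)
  case zero
  then show ?case by (simp add: conL_zero qsum_def tot_def ip_def)
next
  case (step x b c)
  let ?x = "conL d e x m" and ?y = "\<lambda>t. cnj c * conL d e b m t"
  define f where "f z = D j * tot e J L v z - qsum e L (v j) z" for z
  have nn: "0 \<le> f z" for z using qsum_le_conf[OF r2 j] by (simp add: f_def)
  have comb: "a * t1 - q1 + (a * t2 - q2) = 2 * (a * t3 - q3) + 2 * (a * t4 - q4)"
    if "t1 + t2 = 2 * t3 + 2 * t4" "q1 + q2 = 2 * q3 + 2 * q4" for a t1 t2 t3 t4 q1 q2 q3 q4 :: real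
  proof -
    have "a * (t1 + t2) = a * (2 * t3 + 2 * t4)" using that(1) by simp
    with that(2) show ?thesis by (simp add: algebra_simps)
  qed
  have "f ?x = 0" using step.IH by (simp add: f_def)
  moreover have "f ?y = 0" using B[OF step.hyps(2)] by (simp add: f_def qsum_scale tot_scale)
  moreover have "f (\<lambda>t. ?x t + ?y t) + f (\<lambda>t. ?x t - ?y t) = 2 * f ?x + 2 * f ?y"
    unfolding f_def by (rule comb[OF tot_parallelogram qsum_parallelogram])
  ultimately have "f (\<lambda>t. ?x t + ?y t) = 0"
    using nn[of "\<lambda>t. ?x t + ?y t"] nn[of "\<lambda>t. ?x t - ?y t"] by linarith
  then show ?case by (simp add: f_def conL_add_scale)
qed

lemma gain_le_mult:
  assumes t: "tight (d * e) X (K \<times> L) wp P m" and f: "frame_le (d * e) X P m 1" and P: "finite P"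
  shows "gain (d * e) X (K \<times> L) wp P m \<le> pG d I \<eta> \<rho> * pG e J \<mu> \<sigma>"
proof -
  \<comment> \<open>These vectors span the support of the average state of the first
    ensemble.\<close>
  define B where "B = (\<lambda>(i, k). w i k) ` (I \<times> K)"
  have B: "finite B" "\<And>i k. i \<in> I \<Longrightarrow> k \<in> K \<Longrightarrow> w i k \<in> B"
    using fins by (auto simp: B_def)
  obtain \<pi> where \<pi>: "\<And>u. \<pi> u \<in> cspan B" "\<And>u b. b \<in> B \<Longrightarrow> ip d b (\<lambda>i. u i - \<pi> u i) = 0"
    using projection_exists[OF B(1), of d] by metis
  \<comment> \<open>Overlaps with the states do not see the projection, so projecting a family
    changes neither its tightness nor its gain.\<close>
  have w_\<pi>: "qsum d K (w i) (\<pi> u) = qsum d K (w i) u" if "i \<in> I" for i u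
  proof -
    have "ip d (w i k) (\<pi> u) = ip d (w i k) u" if "k \<in> K" for k
      using \<pi>(2)[OF B(2)[OF \<open>i \<in> I\<close> that], of u] by (simp add: ip_diff_right)
    then show ?thesis by (simp add: qsum_def)
  qed
  then have tot_\<pi>: "tot d I K w (\<pi> u) = tot d I K w u" for u by (simp add: tot_def)
  \<comment> \<open>Self-adjointness of the projection up to a phase: both sides have the modulus of
    \<open>ip d (\<pi> u) (\<pi> y)\<close>.\<close>
  have ip_\<pi>: "cmod (ip d (\<pi> u) y) = cmod (ip d u (\<pi> y))" for u y
  proof -
    have "ip d (\<pi> u) (\<lambda>i. y i - \<pi> y i) = 0" "ip d (\<pi> y) (\<lambda>i. u i - \<pi> u i) = 0"
      using cspan_orth[OF \<pi>(1) \<pi>(2)] by blast+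
    then have "ip d (\<pi> u) y = ip d (\<pi> u) (\<pi> y)" "ip d (\<pi> y) u = ip d (\<pi> y) (\<pi> u)"
      by (simp_all add: ip_diff_right)
    then show ?thesis by (metis cmod_ip_commute)
  qed
  define M where "M i j = m (inv_into X g (i, j))" for i j
  have M: "m x p = M (fst (g x)) (snd (g x)) p" if "x \<in> X" for x p
    using that bij by (simp add: M_def bij_betw_def)
  have tM: "both i j (M i j p) = C i * D j * totp (M i j p)" if ijp: "i \<in> I" "j \<in> J" "p \<in> P" for i j p
  proof -
    obtain x where x: "x \<in> X" "g x = (i, j)" using g_surj ijp by blast
    have "qsum (d * e) (K \<times> L) (wp x) (m x p) = Cp x * totp (m x p)"
      using t x(1) ijp(3) by (simp add: tight_def)
    moreover have "m x p = M i j p" "Cp x = C i * D j" "wp x = tfam e (w i) (v j)"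
      using M[OF x(1), of p] conf_product[OF x(1)] x(2) by (simp_all add: wp_def)
    ultimately show ?thesis by simp
  qed
  have fM: "(\<Sum>i\<in>I. \<Sum>j\<in>J. qsum (d * e) P (M i j) u) \<le> nsq (d * e) u" for u
  proof -
    have "(\<Sum>x\<in>X. qsum (d * e) P (m x) u) = (\<Sum>x\<in>X. qsum (d * e) P (M (fst (g x)) (snd (g x))) u)"
      by (simp add: qsum_def M cong: sum.cong)
    also have "\<dots> = (\<Sum>i\<in>I. \<Sum>j\<in>J. qsum (d * e) P (M i j) u)"
      by (rule sum_X)
    finally show ?thesis using f by (metis frame_le_def mult_1)
  qed
  \<comment> \<open>The vectors of the compressed partial trace: contracting with
    \<open>v j l\<close> and summing over \<open>l\<close> traces out the second factor against the
    j-th weighted state.\<close>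
  define n where "n i = (\<lambda>(j, l, p). \<pi> (conR e (v j l) (M i j p)))" for i
  have "tight d I K w (J \<times> L \<times> P) n"
    using tight_product(1)[OF _ _ tM] by (auto simp: tight_def n_def w_\<pi> tot_\<pi>)
  moreover have "frame_le d I (J \<times> L \<times> P) n (pG e J \<mu> \<sigma>)"
    unfolding frame_le_def
  proof
    fix u
    \<comment> \<open>A family on the second factor, obtained by contracting the first with
      \<open>\<pi> u\<close>; the frame bound of \<open>M\<close> on product vectors bounds it by
      \<open>nsq d (\<pi> u)\<close>.\<close>
    define N where "N j = (\<lambda>(i, p). conL d e (\<pi> u) (M i j p))" for j
    \<comment> \<open>Tightness of \<open>M\<close> yields equality for contractions with the
      vectors in \<open>B\<close>; it extends to their span and so to \<open>\<pi> u\<close>. This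
      is the purpose of the compression.\<close>
    have "qsum e L (v j) (conL d e (\<pi> u) (M i j p)) = D j * tot e J L v (conL d e (\<pi> u) (M i j p))"
      if ijp: "i \<in> I" "j \<in> J" "p \<in> P" for i j p
      using ijp(2) \<pi>(1)
    proof (rule tight_cspan)
      fix b assume "b \<in> B"
      then show "qsum e L (v j) (conL d e b (M i j p)) = D j * tot e J L v (conL d e b (M i j p))"
        using tight_product(2)[OF ijp(1,2) tM[OF ijp]] by (auto simp: B_def)
    qed
    then have "tight e J L v (I \<times> P) N"
      by (simp add: tight_def N_def)
    moreover have "frame_le e J (I \<times> P) N (nsq d (\<pi> u))"
      unfolding frame_le_def
    proof
      fix y
      have "(\<Sum>j\<in>J. qsum e (I \<times> P) (N j) y) = (\<Sum>j\<in>J. \<Sum>i\<in>I. qsum (d * e) P (M i j) (tens e (\<pi> u) y))"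
        by (simp add: qsum_def N_def cmod_ip_conL sum_Times)
      also have "\<dots> = (\<Sum>i\<in>I. \<Sum>j\<in>J. qsum (d * e) P (M i j) (tens e (\<pi> u) y))"
        by (rule sum.swap)
      also have "\<dots> \<le> nsq d (\<pi> u) * nsq e y"
        using fM[of "tens e (\<pi> u) y"] by (simp add: nsq_tens)
      finally show "(\<Sum>j\<in>J. qsum e (I \<times> P) (N j) y) \<le> nsq d (\<pi> u) * nsq e y" .
    qed
    ultimately have "gain e J L v (I \<times> P) N \<le> nsq d (\<pi> u) * pG e J \<mu> \<sigma>"
      using P fins by (intro gain_le_pG[OF r2]) (simp_all add: nsq_nonneg)
    also have "\<dots> \<le> nsq d u * pG e J \<mu> \<sigma>"
      using nsq_projection_le[OF \<pi>] pG_nonneg[OF r2] by (intro mult_right_mono)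
    finally have le: "gain e J L v (I \<times> P) N \<le> nsq d u * pG e J \<mu> \<sigma>" .
    \<comment> \<open>Moving the projection onto \<open>u\<close> and exchanging the two
      contractions turns the frame sum of \<open>n\<close> at \<open>u\<close> into the gain of
      \<open>N\<close>.\<close>
    have "(\<Sum>i\<in>I. qsum d (J \<times> L \<times> P) (n i) u)
        = (\<Sum>i\<in>I. \<Sum>j\<in>J. \<Sum>l\<in>L. \<Sum>p\<in>P. (cmod (ip e (v j l) (conL d e (\<pi> u) (M i j p))))\<^sup>2)"
      by (simp add: qsum_def n_def ip_\<pi> cmod_ip_conR sum_Times)
    also have "\<dots> = (\<Sum>i\<in>I. \<Sum>j\<in>J. \<Sum>p\<in>P. \<Sum>l\<in>L. (cmod (ip e (v j l) (conL d e (\<pi> u) (M i j p))))\<^sup>2)"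
      by (intro sum.cong refl sum.swap)
    also have "\<dots> = (\<Sum>j\<in>J. \<Sum>i\<in>I. \<Sum>p\<in>P. \<Sum>l\<in>L. (cmod (ip e (v j l) (conL d e (\<pi> u) (M i j p))))\<^sup>2)"
      by (rule sum.swap)
    also have "\<dots> = gain e J L v (I \<times> P) N"
      by (simp add: gain_def qsum_def N_def sum_Times)
    finally show "(\<Sum>i\<in>I. qsum d (J \<times> L \<times> P) (n i) u) \<le> pG e J \<mu> \<sigma> * nsq d u"
      using le by (simp add: mult.commute)
  qed
  ultimately have "gain d I K w (J \<times> L \<times> P) n \<le> pG e J \<mu> \<sigma> * pG d I \<eta> \<rho>"
    using P fins pG_nonneg[OF r2] by (intro gain_le_pG[OF r1]) simp_all
  moreover have "gain (d * e) X (K \<times> L) wp P m = gain d I K w (J \<times> L \<times> P) n"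
  proof -
    have "gain (d * e) X (K \<times> L) wp P m
        = (\<Sum>x\<in>X. \<Sum>p\<in>P. both (fst (g x)) (snd (g x)) (M (fst (g x)) (snd (g x)) p))"
      by (simp add: gain_def wp_def M cong: sum.cong)
    also have "\<dots> = (\<Sum>i\<in>I. \<Sum>j\<in>J. \<Sum>p\<in>P. both i j (M i j p))"
      by (rule sum_X)
    also have "\<dots> = (\<Sum>i\<in>I. \<Sum>j\<in>J. \<Sum>p\<in>P. \<Sum>l\<in>L. qsum d K (w i) (conR e (v j l) (M i j p)))"
      by (simp add: qsum_tfam_conR)
    also have "\<dots> = (\<Sum>i\<in>I. \<Sum>j\<in>J. \<Sum>l\<in>L. \<Sum>p\<in>P. qsum d K (w i) (conR e (v j l) (M i j p)))"
      by (intro sum.cong refl sum.swap)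
    also have "\<dots> = gain d I K w (J \<times> L \<times> P) n"
      by (simp add: gain_def n_def w_\<pi> sum_Times)
    finally show ?thesis .
  qed
  ultimately show ?thesis by (simp add: mult.commute)
qed

lemma pG_product: "pG (d * e) X \<eta>p \<rho>p = pG d I \<eta> \<rho> * pG e J \<mu> \<sigma>"
  by (intro antisym pG_mult_le pG_le[OF represents_product] gain_le_mult) simp_all

end

section \<open>Passage to ensembles of states and induction over the factors\<close>

lemma pG_kron:
  assumes "ensemble d I \<eta> \<rho>" "ensemble e J \<mu> \<sigma>" "bij_betw g X (I \<times> J)"
  shows "pG (d * e) X (\<lambda>x. \<eta> (fst (g x)) * \<mu> (snd (g x))) (\<lambda>x. kron (\<rho> (fst (g x))) (\<sigma> (snd (g x))))
    = pG d I \<eta> \<rho> * pG e J \<mu> \<sigma>"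
proof -
  obtain w v where "represents d I \<eta> \<rho> {..<d} w" "represents e J \<mu> \<sigma> {..<e} v"
    using ensemble_represents assms(1,2) by metis
  then interpret ensemble_pair d I \<eta> \<rho> "{..<d}" w e J \<mu> \<sigma> "{..<e}" v X g
    using assms(3) by unfold_locales
  show ?thesis using pG_product unfolding \<eta>p_def \<rho>p_def .
qed

lemma ensemble_kron:
  assumes "ensemble d I \<eta> \<rho>" "ensemble e J \<mu> \<sigma>" "bij_betw g X (I \<times> J)"
  shows "ensemble (d * e) X (\<lambda>x. \<eta> (fst (g x)) * \<mu> (snd (g x))) (\<lambda>x. kron (\<rho> (fst (g x))) (\<sigma> (snd (g x))))"
proof -
  have "finite X" using bij_betw_finite[OF assms(3)] assms by (simp add: ensemble_def)
  moreover have "X \<noteq> {}" using assms by (auto simp: ensemble_def bij_betw_def)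
  moreover have "fst (g x) \<in> I" "snd (g x) \<in> J" if "x \<in> X" for x
    using bij_betw_apply[OF assms(3) that] by (auto simp: mem_Times_iff)
  moreover have "(\<Sum>x\<in>X. \<eta> (fst (g x)) * \<mu> (snd (g x))) = sum \<eta> I * sum \<mu> J"
    using sum.reindex_bij_betw[OF assms(3), of "\<lambda>(i, j). \<eta> i * \<mu> j"]
    by (simp add: sum_product sum.cartesian_product case_prod_unfold)
  ultimately show ?thesis using assms by (simp add: ensemble_def density_kron)
qed

lemma tensor_seq_cong: "(\<And>l. l < L \<Longrightarrow> c l = c' l) \<Longrightarrow> tensor_seq L \<rho> c = tensor_seq L \<rho> c'"
  by (induction L) simp_all

text \<open>Restriction resets component \<open>L\<close> to the default value, as membership in the
  shorter function space demands.\<close>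

lemma bij_betw_PiE_Suc:
  fixes A :: "nat \<Rightarrow> 'a set"
  shows "bij_betw (\<lambda>c. (restrict c {..<L}, c L)) (PiE {..<Suc L} A) (PiE {..<L} A \<times> A L)"
  by (rule bij_betw_byWitness[where f' = "\<lambda>(c, a). c(L := a)"])
     (auto simp: PiE_def Pi_def extensional_def fun_eq_iff less_Suc_eq)

lemma ensemble_trivial: "ensemble 1 {x} (\<lambda>_. 1) (\<lambda>_. 1\<^sub>m 1)"
proof -
  have "psd 1 (1\<^sub>m 1)"
    using nsq_nonneg by (simp add: psd_iff_posf posf_def sform_one)
  then show ?thesis by (simp add: ensemble_def density_def mtrace_def)
qed

text \<open>The empty tensor product. The norm of the single state vector bounds the gain by 1, and
  always guessing that state attains it.\<close>

lemma pG_trivial: "pG 1 {x} (\<lambda>_. 1) (\<lambda>_. 1\<^sub>m 1) = 1"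
proof -
  let ?K = "{0} :: nat set" and ?w = "\<lambda>_ _ _. 1 :: complex"
  have q: "qsum 1 ?K (\<lambda>_ _. 1) u = (cmod (u 0))\<^sup>2" for u
    by (simp add: qsum_def ip_def)
  have r: "represents 1 {x} (\<lambda>_. 1) (\<lambda>_. 1\<^sub>m 1) ?K ?w"
  proof -
    have "0 < qsum 1 ?K (\<lambda>_ _. 1) (\<lambda>_. 1)" unfolding q by simp
    then show ?thesis by (auto simp: represents_def gram_def simp del: One_nat_def)
  qed
  have ns: "nsq 1 u = (cmod (u 0))\<^sup>2" for u by (simp add: nsq_def)
  have t: "tot 1 {x} ?K ?w u = (cmod (u 0))\<^sup>2" for u by (simp add: tot_def q del: One_nat_def)
  have c: "conf 1 {x} ?K ?w x = 1"
  proof (rule antisym)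
    show "conf 1 {x} ?K ?w x \<le> 1" by (rule conf_le[OF r]) (simp_all add: q t del: One_nat_def)
    show "1 \<le> conf 1 {x} ?K ?w x" using qsum_le_conf[OF r, of x "\<lambda>_. 1"] by (simp add: q t del: One_nat_def)
  qed
  show ?thesis
  proof (rule antisym)
    show "pG 1 {x} (\<lambda>_. 1) (\<lambda>_. 1\<^sub>m 1) \<le> 1"
      using gain_le_of_frame[of 1 "{x}" _ _ ?K ?w]
      by (intro pG_le[OF r]) (fastforce simp: ns simp del: One_nat_def)
    have "gain 1 {x} ?K ?w ?K ?w \<le> 1 * pG 1 {x} (\<lambda>_. 1) (\<lambda>_. 1\<^sub>m 1)"
      by (rule gain_le_pG[OF r]) (simp_all add: tight_def frame_le_def q t c ns del: One_nat_def)
    then show "1 \<le> pG 1 {x} (\<lambda>_. 1) (\<lambda>_. 1\<^sub>m 1)" by (simp add: gain_def q del: One_nat_def)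
  qed
qed

theorem theorem6:
  fixes L :: nat and d n :: "nat \<Rightarrow> nat"
    and \<eta> :: "nat \<Rightarrow> nat \<Rightarrow> real" and \<rho> :: "nat \<Rightarrow> nat \<Rightarrow> complex mat"
  assumes "\<forall>l<L. ensemble (d l) {..<n l} (\<eta> l) (\<rho> l)"
  shows "pG (\<Prod>l<L. d l) (PiE {..<L} (\<lambda>l. {..<n l}))
            (\<lambda>c. \<Prod>l<L. \<eta> l (c l)) (\<lambda>c. tensor_seq L \<rho> c)
         = (\<Prod>l<L. pG (d l) {..<n l} (\<eta> l) (\<rho> l))"
proof -
  \<comment> \<open>The ensemble property joins the induction claim because \<open>pG_kron\<close>
    requires it of the product of the first \<open>L\<close> factors.\<close>
  have "ensemble (\<Prod>l<L. d l) (PiE {..<L} (\<lambda>l. {..<n l})) (\<lambda>c. \<Prod>l<L. \<eta> l (c l)) (\<lambda>c. tensor_seq L \<rho> c) \<and>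
    pG (\<Prod>l<L. d l) (PiE {..<L} (\<lambda>l. {..<n l})) (\<lambda>c. \<Prod>l<L. \<eta> l (c l)) (\<lambda>c. tensor_seq L \<rho> c)
         = (\<Prod>l<L. pG (d l) {..<n l} (\<eta> l) (\<rho> l))"
    using assms
  proof (induction L)
    case 0
    \<comment> \<open>The only extensional function on the empty index set is
      \<open>\<lambda>_. undefined\<close>, which plays the empty sequence.\<close>
    show ?case
      using ensemble_trivial[of "\<lambda>_. undefined"] pG_trivial[of "\<lambda>_. undefined"]
      by (simp add: PiE_empty_domain)
  next
    case (Suc L)
    let ?g = "\<lambda>c :: nat \<Rightarrow> nat. (restrict c {..<L}, c L)"
    have "\<forall>l<L. ensemble (d l) {..<n l} (\<eta> l) (\<rho> l)" using Suc.prems by simp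
    note IH = Suc.IH[OF this, THEN conjunct1] Suc.IH[OF this, THEN conjunct2]
    have e: "ensemble (d L) {..<n L} (\<eta> L) (\<rho> L)" using Suc.prems by simp
    have ts: "tensor_seq L \<rho> (restrict c {..<L}) = tensor_seq L \<rho> c" for c
      by (rule tensor_seq_cong) simp
    have bij: "bij_betw ?g (PiE {..<Suc L} (\<lambda>l. {..<n l})) (PiE {..<L} (\<lambda>l. {..<n l}) \<times> {..<n L})"
      by (rule bij_betw_PiE_Suc)
    show ?case
      using ensemble_kron[OF IH(1) e bij] pG_kron[OF IH(1) e bij] IH(2)
      unfolding fst_conv snd_conv ts by simp
  qed
  then show ?thesis ..
qed

end
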